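(* Let $H$ be a computable Hilbert space and $(H_i)_{i\in\mathbb N}$ a sequence of computable Hilbert spaces, with $(e_{ij})_{j\in\mathbb N}$ a computable orthonormal basis of $H_i$ for each $i$. If $\{\Lambda_i:i\in\mathbb N\}$ is a computable $g$-frame for $H$ with respect to $\{H_i:i\in\mathbb N\}$ such that $\{\|\Lambda_i^*e_{ij}\|:i,j\in\mathbb N\}$ is a computable double sequence of reals, then $\{\Lambda_i^*e_{ij}:i,j\in\mathbb N\}$ is a computable frame for $H$.
   Context: Computability is in the sense of representation-based computable analysis (Type-2 Turing machines). A computable Hilbert space $(H,\langle\cdot,\cdot\rangle,e)$ is a separable Hilbert space with a sequence $e:\mathbb N\to H$ whose linear span is dense such that, for a standard enumeration $\alpha_e$ of finite linear combinations of the $e_i$ with coefficients from a standard countable dense subset of the scalar field, the distances $\|\alpha_e(n)-\alpha_e(m)\|$ form a computable double sequence; it is represented by its Cauchy representation $\delta_H$ (a name of $x$ encodes $(n_k)$ with $\|\alpha_e(n_k)-\alpha_e(n_l)\|<2^{-k}$ for $l>k$ and $x=\lim\alpha_e(n_k)$). A (double) sequence is computable if the map from indices to elements is computable. $[\delta\to\delta']$ denotes the standard representation of continuous functions. A frame for $H$ is a sequence $(f_k)$ with constants $0<A\le B$ such that $A\|f\|^2\le\sum_k|\langle f,f_k\rangle|^2\le B\|f\|^2$ for all $f\in H$; a computable frame is a frame which is a computable sequence in $(H,\delta_H)$. A sequence $\Lambda_i\in L(H,H_i)$ is a $g$-frame for $H$ with respect to $\{H_i\}$ if there are $0<A\le B<\infty$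 with $A\|f\|^2\le\sum_i\|\Lambda_if\|^2\le B\|f\|^2$ for all $f\in H$; it is a computable $g$-frame if moreover $(\Lambda_i)$ is a computable sequence, i.e. from $i$ one can compute a $[\delta_H\to\delta_{H_i}]$-name of $\Lambda_i$.
   Formalization: The spaces H_i and the orthonormal bases (e_ij) are required to be computable uniformly in i (distances in H_i and names of e_ij computable from i), not merely for each i separately; without this uniformity the claim fails. *)

theory Defs
  imports Complex_Main "HOL-Library.Nat_Bijection"
begin

section \<open>Computable functions on Baire space\<close>

type_synonym baire = "nat \<Rightarrow> nat"

text \<open>
  \<open>partrec \<Phi>\<close>: \<open>\<Phi>\<close> is a partial recursive functional, i.e. \<open>\<Phi> p n\<close> is the (possibly
  undefined) result of running some fixed program on input \<open>n\<close> that may query \<open>p\<close>. Several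
  arguments are passed through the Cantor pairing function \<open>prod_encode\<close>. A partial function
  \<open>F\<close> on Baire space is computed by a Type-2 Turing machine iff some such \<open>\<Phi>\<close> produces the
  \<open>n\<close>-th entry of \<open>F p\<close> from \<open>n\<close> by querying \<open>p\<close>.
\<close>

inductive partrec :: "(baire \<Rightarrow> nat \<Rightarrow> nat option) \<Rightarrow> bool" where
  zero: "partrec (\<lambda>p n. Some 0)"
| succ: "partrec (\<lambda>p n. Some (Suc n))"
| left: "partrec (\<lambda>p n. Some (fst (prod_decode n)))"
| right: "partrec (\<lambda>p n. Some (snd (prod_decode n)))"
| query: "partrec (\<lambda>p n. Some (p n))"
| pair: "partrec f \<Longrightarrow> partrec g \<Longrightarrow>
    partrec (\<lambda>p n. Option.bind (f p n) (\<lambda>a. map_option (\<lambda>b. prod_encode (a, b)) (g p n)))"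
| comp: "partrec f \<Longrightarrow> partrec g \<Longrightarrow> partrec (\<lambda>p n. Option.bind (g p n) (f p))"
| prec: "partrec f \<Longrightarrow> partrec g \<Longrightarrow>
    partrec (\<lambda>p n. case prod_decode n of (a, m) \<Rightarrow>
      rec_nat (f p a)
        (\<lambda>k r. Option.bind r (\<lambda>y. g p (prod_encode (a, prod_encode (k, y))))) m)"
| mu: "partrec f \<Longrightarrow>
    partrec (\<lambda>p n.
      if \<exists>m. f p (prod_encode (n, m)) = Some 0 \<and> (\<forall>k<m. f p (prod_encode (n, k)) \<noteq> None)
      then Some (LEAST m. f p (prod_encode (n, m)) = Some 0) else None)"

definition computes :: "(baire \<Rightarrow> nat \<Rightarrow> nat option) \<Rightarrow> baire \<Rightarrow> baire \<Rightarrow> bool" where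
  "computes \<Phi> p q \<longleftrightarrow> (\<forall>n. \<Phi> p n = Some (q n))"


section \<open>Representations\<close>

text \<open>\<open>\<delta> p x\<close>: \<open>p\<close> is a \<open>\<delta>\<close>-name of \<open>x\<close>, that is, \<open>\<delta>(p) = x\<close>.\<close>

type_synonym 'x rep = "baire \<Rightarrow> 'x \<Rightarrow> bool"

text \<open>
  From a \<open>\<delta>\<close>-name of \<open>i\<close> one can compute a \<open>\<delta>' i\<close>-name of \<open>x i\<close>. The representation on the
  output side may depend on \<open>i\<close>, because the points \<open>x i\<close> may belong to different spaces.
\<close>

definition computable_family :: "'i rep \<Rightarrow> ('i \<Rightarrow> 'x rep) \<Rightarrow> ('i \<Rightarrow> 'x) \<Rightarrow> bool" where
  "computable_family \<delta> \<delta>' x \<longleftrightarrow>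
    (\<exists>\<Phi>. partrec \<Phi> \<and> (\<forall>p i. \<delta> p i \<longrightarrow> (\<exists>q. computes \<Phi> p q \<and> \<delta>' i q (x i))))"

abbreviation computable_map :: "'x rep \<Rightarrow> 'y rep \<Rightarrow> ('x \<Rightarrow> 'y) \<Rightarrow> bool" where
  "computable_map \<delta> \<delta>' f \<equiv> computable_family \<delta> (\<lambda>_. \<delta>') f"

definition nat_rep :: "nat rep" where
  "nat_rep p n \<longleftrightarrow> p 0 = n"

definition prod_rep :: "'x rep \<Rightarrow> 'y rep \<Rightarrow> ('x \<times> 'y) rep" where
  "prod_rep \<delta> \<delta>' p z \<longleftrightarrow> \<delta> (\<lambda>n. p (2 * n)) (fst z) \<and> \<delta>' (\<lambda>n. p (2 * n + 1)) (snd z)"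

definition cauchy_rep :: "'x set \<Rightarrow> ('x \<Rightarrow> 'x \<Rightarrow> real) \<Rightarrow> (nat \<Rightarrow> 'x) \<Rightarrow> 'x rep" where
  "cauchy_rep X d \<alpha> p x \<longleftrightarrow> x \<in> X \<and>
    (\<forall>k l. k < l \<longrightarrow> d (\<alpha> (p k)) (\<alpha> (p l)) < (1/2) ^ k) \<and>
    (\<lambda>k. d (\<alpha> (p k)) x) \<longlonglongrightarrow> 0"

definition rat_enum :: "nat \<Rightarrow> real" where
  "rat_enum n = (case prod_decode n of (a, k) \<Rightarrow> case prod_decode a of (i, j) \<Rightarrow>
    (real i - real j) / (real k + 1))"

definition real_rep :: "real rep" where
  "real_rep = cauchy_rep UNIV dist rat_enum"

text \<open>
  The function space representation \<open>[\<delta> \<rightarrow> \<delta>']\<close>. Every \<open>p\<close> is read as (an associate of) a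
  partial continuous function \<open>\<eta>\<^sub>p\<close> on Baire space: to find the \<open>n\<close>-th entry of \<open>\<eta>\<^sub>p(q)\<close>, apply
  \<open>p\<close> to \<open>n\<close> together with longer and longer prefixes of \<open>q\<close>; the value \<open>0\<close> asks for more
  input, the value \<open>Suc m\<close> gives the answer \<open>m\<close>. A name of \<open>f\<close> is a \<open>p\<close> for which \<open>\<eta>\<^sub>p\<close> maps
  \<open>\<delta>\<close>-names of \<open>x\<close> to \<open>\<delta>'\<close>-names of \<open>f x\<close>; values of \<open>f\<close> at points without a
  \<open>\<delta>\<close>-name are irrelevant.
\<close>

definition eta :: "baire \<Rightarrow> baire \<Rightarrow> baire \<Rightarrow> bool" where
  "eta p q r \<longleftrightarrow> (\<forall>n. \<exists>k.
    p (prod_encode (n, list_encode (map q [0..<k]))) = Suc (r n) \<and>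
    (\<forall>j<k. p (prod_encode (n, list_encode (map q [0..<j]))) = 0))"

definition fun_rep :: "'x rep \<Rightarrow> 'y rep \<Rightarrow> ('x \<Rightarrow> 'y) rep" where
  "fun_rep \<delta> \<delta>' p f \<longleftrightarrow> (\<forall>q x. \<delta> q x \<longrightarrow> (\<exists>r. eta p q r \<and> \<delta>' r (f x)))"


section \<open>Hilbert spaces over the real or complex numbers\<close>

text \<open>
  Hilbert spaces are given with an explicit carrier so that the members of a sequence of
  spaces may differ. The scalar field \<open>K\<close> is a set of complex numbers, \<open>\<real>\<close> or \<open>UNIV\<close>; the
  inner product is linear in its first argument.
\<close>

record 'a hilbert =
  hcarrier :: "'a set"
  hscale :: "complex \<Rightarrow> 'a \<Rightarrow> 'a"
  hinner :: "'a \<Rightarrow> 'a \<Rightarrow> complex"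

definition hnorm :: "('a, 'm) hilbert_scheme \<Rightarrow> 'a \<Rightarrow> real" where
  "hnorm H x = sqrt (Re (hinner H x x))"

definition hdist :: "('a::ab_group_add, 'm) hilbert_scheme \<Rightarrow> 'a \<Rightarrow> 'a \<Rightarrow> real" where
  "hdist H x y = hnorm H (x - y)"

locale hilbert_space =
  fixes K :: "complex set" and H :: "'a::ab_group_add hilbert"
  assumes scalars: "K = \<real> \<or> K = UNIV"
    and zero_closed: "0 \<in> hcarrier H"
    and add_closed: "x \<in> hcarrier H \<Longrightarrow> y \<in> hcarrier H \<Longrightarrow> x + y \<in> hcarrier H"
    and scale_closed: "c \<in> K \<Longrightarrow> x \<in> hcarrier H \<Longrightarrow> hscale H c x \<in> hcarrier H"
    and scale_add_right: "c \<in> K \<Longrightarrow> x \<in> hcarrier H \<Longrightarrow> y \<in> hcarrier H \<Longrightarrow>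
      hscale H c (x + y) = hscale H c x + hscale H c y"
    and scale_add_left: "c \<in> K \<Longrightarrow> d \<in> K \<Longrightarrow> x \<in> hcarrier H \<Longrightarrow>
      hscale H (c + d) x = hscale H c x + hscale H d x"
    and scale_scale: "c \<in> K \<Longrightarrow> d \<in> K \<Longrightarrow> x \<in> hcarrier H \<Longrightarrow>
      hscale H c (hscale H d x) = hscale H (c * d) x"
    and scale_one: "x \<in> hcarrier H \<Longrightarrow> hscale H 1 x = x"
    and inner_scalar: "x \<in> hcarrier H \<Longrightarrow> y \<in> hcarrier H \<Longrightarrow> hinner H x y \<in> K"
    and inner_commute: "x \<in> hcarrier H \<Longrightarrow> y \<in> hcarrier H \<Longrightarrow>
      hinner H x y = cnj (hinner H y x)"
    and inner_add: "x \<in> hcarrier H \<Longrightarrow> y \<in> hcarrier H \<Longrightarrow> z \<in> hcarrier H \<Longrightarrow>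
      hinner H (x + y) z = hinner H x z + hinner H y z"
    and inner_scale: "c \<in> K \<Longrightarrow> x \<in> hcarrier H \<Longrightarrow> y \<in> hcarrier H \<Longrightarrow>
      hinner H (hscale H c x) y = c * hinner H x y"
    and inner_nonneg: "x \<in> hcarrier H \<Longrightarrow> Re (hinner H x x) \<ge> 0"
    and inner_definite: "x \<in> hcarrier H \<Longrightarrow> hinner H x x = 0 \<Longrightarrow> x = 0"
    and complete: "\<lbrakk>\<And>n. X n \<in> hcarrier H;
        \<And>\<epsilon>. \<epsilon> > 0 \<Longrightarrow> \<exists>N. \<forall>m\<ge>N. \<forall>n\<ge>N. hdist H (X m) (X n) < \<epsilon>\<rbrakk> \<Longrightarrow>
      \<exists>x\<in>hcarrier H. (\<lambda>n. hdist H (X n) x) \<longlonglongrightarrow> 0"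

definition hspan :: "complex set \<Rightarrow> 'a::ab_group_add hilbert \<Rightarrow> 'a set \<Rightarrow> 'a set" where
  "hspan K H S =
    {(\<Sum>s\<in>F. hscale H (c s) s) | F c. finite F \<and> F \<subseteq> S \<and> (\<forall>s\<in>F. c s \<in> K)}"

definition hdense :: "'a::ab_group_add hilbert \<Rightarrow> 'a set \<Rightarrow> bool" where
  "hdense H D \<longleftrightarrow> D \<subseteq> hcarrier H \<and>
    (\<forall>x\<in>hcarrier H. \<forall>\<epsilon>>0. \<exists>y\<in>D. hdist H x y < \<epsilon>)"

definition orthonormal_basis ::
  "complex set \<Rightarrow> 'a::ab_group_add hilbert \<Rightarrow> (nat \<Rightarrow> 'a) \<Rightarrow> bool" where
  "orthonormal_basis K H b \<longleftrightarrow> range b \<subseteq> hcarrier H \<and>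
    (\<forall>i j. hinner H (b i) (b j) = (if i = j then 1 else 0)) \<and>
    hdense H (hspan K H (range b))"

definition bounded_operator :: "complex set \<Rightarrow> 'a::ab_group_add hilbert \<Rightarrow>
    'b::ab_group_add hilbert \<Rightarrow> ('a \<Rightarrow> 'b) \<Rightarrow> bool" where
  "bounded_operator K H G T \<longleftrightarrow>
    (\<forall>x\<in>hcarrier H. T x \<in> hcarrier G) \<and>
    (\<forall>x\<in>hcarrier H. \<forall>y\<in>hcarrier H. T (x + y) = T x + T y) \<and>
    (\<forall>c\<in>K. \<forall>x\<in>hcarrier H. T (hscale H c x) = hscale G c (T x)) \<and>
    (\<exists>M. \<forall>x\<in>hcarrier H. hnorm G (T x) \<le> M * hnorm H x)"

definition hadjoint :: "'a hilbert \<Rightarrow> 'b hilbert \<Rightarrow> ('a \<Rightarrow> 'b) \<Rightarrow> 'b \<Rightarrow> 'a" where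
  "hadjoint H G T y = (THE z. z \<in> hcarrier H \<and>
    (\<forall>x\<in>hcarrier H. hinner G (T x) y = hinner H x z))"


section \<open>Computable Hilbert spaces\<close>

text \<open>Enumerates the rationals if \<open>K = \<real>\<close> and the Gaussian rationals if \<open>K = UNIV\<close>.\<close>

definition scalar_enum :: "complex set \<Rightarrow> nat \<Rightarrow> complex" where
  "scalar_enum K n = (if K = \<real> then complex_of_real (rat_enum n)
    else case prod_decode n of (a, b) \<Rightarrow> Complex (rat_enum a) (rat_enum b))"

definition lincomb_enum ::
  "complex set \<Rightarrow> 'a::ab_group_add hilbert \<Rightarrow> (nat \<Rightarrow> 'a) \<Rightarrow> nat \<Rightarrow> 'a" where
  "lincomb_enum K H e n =
    (let cs = list_decode n in \<Sum>k<length cs. hscale H (scalar_enum K (cs ! k)) (e k))"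

definition hilbert_rep ::
  "complex set \<Rightarrow> 'a::ab_group_add hilbert \<Rightarrow> (nat \<Rightarrow> 'a) \<Rightarrow> 'a rep" where
  "hilbert_rep K H e = cauchy_rep (hcarrier H) (hdist H) (lincomb_enum K H e)"

definition computable_hilbert ::
  "complex set \<Rightarrow> 'a::ab_group_add hilbert \<Rightarrow> (nat \<Rightarrow> 'a) \<Rightarrow> bool" where
  "computable_hilbert K H e \<longleftrightarrow> hilbert_space K H \<and>
    range e \<subseteq> hcarrier H \<and> hdense H (hspan K H (range e)) \<and>
    computable_map (prod_rep nat_rep nat_rep) real_rep
      (\<lambda>(n, m). hdist H (lincomb_enum K H e n) (lincomb_enum K H e m))"

text \<open>
  A sequence of computable Hilbert spaces: the distances on the \<open>i\<close>-th space have to be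
  computable uniformly in \<open>i\<close>.
\<close>

definition computable_hilbert_seq ::
  "complex set \<Rightarrow> (nat \<Rightarrow> 'a::ab_group_add hilbert) \<Rightarrow> (nat \<Rightarrow> nat \<Rightarrow> 'a) \<Rightarrow> bool" where
  "computable_hilbert_seq K Hs es \<longleftrightarrow> (\<forall>i. computable_hilbert K (Hs i) (es i)) \<and>
    computable_map (prod_rep nat_rep (prod_rep nat_rep nat_rep)) real_rep
      (\<lambda>(i, n, m). hdist (Hs i)
        (lincomb_enum K (Hs i) (es i) n) (lincomb_enum K (Hs i) (es i) m))"

text \<open>\<open>b i\<close> is an orthonormal basis of the \<open>i\<close>-th space, computable uniformly in \<open>i\<close>.\<close>

definition computable_orthonormal_bases ::
  "complex set \<Rightarrow> (nat \<Rightarrow> 'a::ab_group_add hilbert) \<Rightarrow> (nat \<Rightarrow> nat \<Rightarrow> 'a) \<Rightarrow>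
    (nat \<Rightarrow> nat \<Rightarrow> 'a) \<Rightarrow> bool" where
  "computable_orthonormal_bases K Hs es b \<longleftrightarrow> (\<forall>i. orthonormal_basis K (Hs i) (b i)) \<and>
    computable_family (prod_rep nat_rep nat_rep)
      (\<lambda>(i, j). hilbert_rep K (Hs i) (es i)) (\<lambda>(i, j). b i j)"


section \<open>Frames and g-frames\<close>

definition frame :: "'a::ab_group_add hilbert \<Rightarrow> (nat \<Rightarrow> 'a) \<Rightarrow> bool" where
  "frame H f \<longleftrightarrow> range f \<subseteq> hcarrier H \<and>
    (\<exists>A B. 0 < A \<and> A \<le> B \<and> (\<forall>x\<in>hcarrier H.
      summable (\<lambda>k. (cmod (hinner H x (f k)))\<^sup>2) \<and>
      A * (hnorm H x)\<^sup>2 \<le> (\<Sum>k. (cmod (hinner H x (f k)))\<^sup>2) \<and>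
      (\<Sum>k. (cmod (hinner H x (f k)))\<^sup>2) \<le> B * (hnorm H x)\<^sup>2))"

definition computable_frame ::
  "complex set \<Rightarrow> 'a::ab_group_add hilbert \<Rightarrow> (nat \<Rightarrow> 'a) \<Rightarrow> (nat \<Rightarrow> 'a) \<Rightarrow> bool" where
  "computable_frame K H e f \<longleftrightarrow>
    frame H f \<and> computable_map nat_rep (hilbert_rep K H e) f"

definition g_frame :: "complex set \<Rightarrow> 'a::ab_group_add hilbert \<Rightarrow>
    (nat \<Rightarrow> 'b::ab_group_add hilbert) \<Rightarrow> (nat \<Rightarrow> 'a \<Rightarrow> 'b) \<Rightarrow> bool" where
  "g_frame K H Hs \<Lambda> \<longleftrightarrow> (\<forall>i. bounded_operator K H (Hs i) (\<Lambda> i)) \<and>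
    (\<exists>A B. 0 < A \<and> A \<le> B \<and> (\<forall>x\<in>hcarrier H.
      summable (\<lambda>i. (hnorm (Hs i) (\<Lambda> i x))\<^sup>2) \<and>
      A * (hnorm H x)\<^sup>2 \<le> (\<Sum>i. (hnorm (Hs i) (\<Lambda> i x))\<^sup>2) \<and>
      (\<Sum>i. (hnorm (Hs i) (\<Lambda> i x))\<^sup>2) \<le> B * (hnorm H x)\<^sup>2))"

definition computable_g_frame ::
  "complex set \<Rightarrow> 'a::ab_group_add hilbert \<Rightarrow> (nat \<Rightarrow> 'a) \<Rightarrow>
    (nat \<Rightarrow> 'b::ab_group_add hilbert) \<Rightarrow> (nat \<Rightarrow> nat \<Rightarrow> 'b) \<Rightarrow> (nat \<Rightarrow> 'a \<Rightarrow> 'b) \<Rightarrow> bool" where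
  "computable_g_frame K H e Hs es \<Lambda> \<longleftrightarrow> g_frame K H Hs \<Lambda> \<and>
    computable_family nat_rep
      (\<lambda>i. fun_rep (hilbert_rep K H e) (hilbert_rep K (Hs i) (es i))) \<Lambda>"

end

(*
  Write f_ij for the adjoint of Lambda_i applied to e_ij, and a_m for the dense sequence of H.
  Parseval's identity in H_i gives sum_j |<x, f_ij>|^2 = |Lambda_i x|^2, so the g-frame bounds are
  frame bounds. For computability, polarization yields
    |a_m - f_ij|^2 = |a_m|^2 + |f_ij|^2 - |Lambda_i a_m|^2 - 1 + |Lambda_i a_m - e_ij|^2,
  all of whose terms are computable because |f_ij| is; hence a search over m finds, for every k,
  some a_m within distance 2^(-k-1) of f_ij. Since every point of Baire space names a natural
  number, all the oracle computations involved reduce to total recursive functions on nat.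
*)
theory Submission
  imports Defs "HOL-Analysis.Infinite_Sum" "HOL-Analysis.Elementary_Metric_Spaces"
begin

section \<open>Total recursive functions\<close>

text \<open>Names of the Lambda_i and of the e_ij yield the numbers <a_m, f_ij>, but these describe
  f_ij only weakly; knowing |f_ij| turns them into control of the distance in norm. Comparison of
  reals is merely semidecidable, so the search cannot test a distance itself. It tests rational
  upper bounds that converge to the squared distance: the bound makes every accepted a_m correct,
  while convergence together with density makes the search end. Working with squares keeps
  everything inside rational arithmetic. The reduction to functions on \<open>nat\<close> rests on
  two facts: an index has a name that is recursive in it, and a_m has a constant name, on which a
  name of Lambda_i can be evaluated.\<close>

definition recursive :: "(nat \<Rightarrow> nat) \<Rightarrow> bool" where
  "recursive f \<longleftrightarrow> partrec (\<lambda>p n. Some (f n))"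

abbreviation pfst :: "nat \<Rightarrow> nat" where "pfst x \<equiv> fst (prod_decode x)"
abbreviation psnd :: "nat \<Rightarrow> nat" where "psnd x \<equiv> snd (prod_decode x)"

definition recursive2 :: "(nat \<Rightarrow> nat \<Rightarrow> nat) \<Rightarrow> bool" where
  "recursive2 f \<longleftrightarrow> recursive (\<lambda>x. f (pfst x) (psnd x))"

definition recursive3 :: "(nat \<Rightarrow> nat \<Rightarrow> nat \<Rightarrow> nat) \<Rightarrow> bool" where
  "recursive3 f \<longleftrightarrow> recursive2 (\<lambda>a x. f a (pfst x) (psnd x))"

named_theorems recursive_intros

text \<open>Composition in the presence of a parameter: the first component of the input is saved
  and handed on to the outer functional. Replacing the oracle needs exactly this form.\<close>

lemma partrec_bind:
  assumes "partrec f" "partrec g"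
  shows "partrec (\<lambda>p x. Option.bind (g p x) (\<lambda>y. f p (prod_encode (pfst x, y))))"
  using partrec.comp[OF assms(1) partrec.pair[OF partrec.left assms(2)]]
  by (auto simp: Option.bind_map_option o_def elim!: back_subst[where P=partrec])

lemma recursive_compose:
  assumes "recursive f" "recursive g" shows "recursive (\<lambda>x. f (g x))"
  using partrec.comp[OF assms[unfolded recursive_def]] by (simp add: recursive_def)

lemma recursive_Suc [recursive_intros]: "recursive f \<Longrightarrow> recursive (\<lambda>x. Suc (f x))"
  using recursive_compose[of Suc] partrec.succ by (simp add: recursive_def)

lemma recursive_const [recursive_intros]: "recursive (\<lambda>x. c)"
proof (induction c)
  case 0 then show ?case using partrec.zero by (simp add: recursive_def)
qed (rule recursive_Suc)

lemma recursive_pair [recursive_intros]: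
  "recursive f \<Longrightarrow> recursive g \<Longrightarrow> recursive (\<lambda>x. prod_encode (f x, g x))"
  unfolding recursive_def by (drule (1) partrec.pair) simp

lemma recursive_fst [recursive_intros]: "recursive f \<Longrightarrow> recursive (\<lambda>x. pfst (f x))"
  using recursive_compose[of pfst] partrec.left by (simp add: recursive_def)

lemma recursive_snd [recursive_intros]: "recursive f \<Longrightarrow> recursive (\<lambda>x. psnd (f x))"
  using recursive_compose[of psnd] partrec.right by (simp add: recursive_def)

text \<open>Projections are primitive but the identity is not; decoding a number and encoding it
  again supplies it.\<close>

lemma recursive_id [recursive_intros]: "recursive (\<lambda>x. x)"
  using partrec.pair[OF partrec.left partrec.right] by (simp add: recursive_def)

lemma recursive2_compose:
  "recursive2 f \<Longrightarrow> recursive g \<Longrightarrow> recursive h \<Longrightarrow> recursive (\<lambda>x. f (g x) (h x))"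
  unfolding recursive2_def by (drule recursive_compose[OF _ recursive_pair]) auto

lemma recursive3_compose:
  "recursive3 f \<Longrightarrow> recursive g \<Longrightarrow> recursive h \<Longrightarrow> recursive k \<Longrightarrow>
    recursive (\<lambda>x. f (g x) (h x) (k x))"
  unfolding recursive3_def
  by (drule recursive2_compose[OF _ _ recursive_pair, of _ g h k]) auto

text \<open>With total base and step no intermediate value of \<open>prec\<close> is
  \<open>None\<close>, so its recursion on options collapses to \<open>rec_nat\<close>.\<close>

lemma recursive_rec_nat:
  assumes "recursive f" "recursive3 s" "recursive h"
  shows "recursive (\<lambda>x. rec_nat (f x) (s x) (h x))"
proof -
  have *: "rec_nat (Some a) (\<lambda>k r. Option.bind r (\<lambda>y. Some (t k y))) m = Some (rec_nat a t m)"
    for a :: nat and t m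
    by (induction m) auto
  have "recursive2 (\<lambda>a m. rec_nat (f a) (s a) m)"
    using partrec.prec[of "\<lambda>p n. Some (f n)" "\<lambda>p n. Some (s (pfst n) (pfst (psnd n)) (psnd (psnd n)))"]
      assms(1,2)
    by (simp add: recursive_def recursive2_def recursive3_def case_prod_beta *)
  then show ?thesis
    by (rule recursive2_compose[OF _ recursive_id assms(3)])
qed

text \<open>All values are defined and a zero exists, so the definedness test in \<open>mu\<close>
  always succeeds.\<close>

lemma recursive_Least:
  assumes "recursive2 f" "\<And>x. \<exists>m. f x m = 0"
  shows "recursive (\<lambda>x. LEAST m. f x m = 0)"
  using partrec.mu[of "\<lambda>p n. Some (f (pfst n) (psnd n))"] assms
  by (simp add: recursive_def recursive2_def)

section \<open>Arithmetic and case distinction\<close>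

lemma recursive_add [recursive_intros]:
  assumes "recursive f" "recursive g" shows "recursive (\<lambda>x. f x + g x)"
proof -
  have "recursive (\<lambda>x. rec_nat (f x) (\<lambda>_. Suc) (g x))"
    by (rule recursive_rec_nat) (auto simp: recursive2_def recursive3_def intro!: recursive_intros assms)
  moreover have "rec_nat a (\<lambda>_. Suc) b = a + b" for a b by (induction b) auto
  ultimately show ?thesis by simp
qed

lemma recursive_mult [recursive_intros]:
  assumes "recursive f" "recursive g" shows "recursive (\<lambda>x. f x * g x)"
proof -
  have "recursive (\<lambda>x. rec_nat 0 (\<lambda>_ r. r + f x) (g x))"
    by (rule recursive_rec_nat[where s="\<lambda>x k r. r + f x"])
      (auto simp: recursive2_def recursive3_def
        intro!: recursive_intros assms recursive_compose[OF assms(1)])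
  moreover have "rec_nat 0 (\<lambda>_ r. r + a) b = a * b" for a b :: nat by (induction b) auto
  ultimately show ?thesis by simp
qed

lemma recursive_diff [recursive_intros]:
  assumes "recursive f" "recursive g" shows "recursive (\<lambda>x. f x - g x)"
proof -
  \<comment> \<open>Recursion that returns its counter and discards the previous value is the
    predecessor; iterating the predecessor gives truncated subtraction.\<close>
  have "recursive (\<lambda>x. rec_nat 0 (\<lambda>k _. k) x)"
    by (rule recursive_rec_nat)
      (auto simp: recursive2_def recursive3_def intro!: recursive_intros)
  moreover have "rec_nat 0 (\<lambda>k _. k) x = x - 1" for x :: nat by (cases x) auto
  ultimately have pred: "recursive (\<lambda>x. x - 1)" by simp
  have "recursive (\<lambda>x. rec_nat (f x) (\<lambda>_ r. r - 1) (g x))"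
    by (rule recursive_rec_nat)
      (auto simp: recursive2_def recursive3_def intro!: recursive_intros assms
        recursive_compose[OF pred, simplified])
  moreover have "rec_nat a (\<lambda>_ r. r - 1) b = a - b" for a b :: nat by (induction b) auto
  ultimately show ?thesis by simp
qed

lemma recursive_power [recursive_intros]:
  assumes "recursive f" "recursive g" shows "recursive (\<lambda>x. f x ^ g x)"
proof -
  have "recursive (\<lambda>x. rec_nat 1 (\<lambda>_ r. f x * r) (g x))"
    by (rule recursive_rec_nat[where s="\<lambda>x k r. f x * r"])
      (auto simp: recursive2_def recursive3_def
        intro!: recursive_intros assms recursive_compose[OF assms(1)])
  moreover have "rec_nat 1 (\<lambda>_ r. a * r) b = a ^ b" for a b :: nat by (induction b) auto
  ultimately show ?thesis by simp
qed

text \<open>A recursion whose step ignores the previous value only distinguishes zero from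
  successor. Decisions below are therefore phrased as tests for 0.\<close>

lemma recursive_if_zero [recursive_intros]:
  assumes "recursive c" "recursive f" "recursive g"
  shows "recursive (\<lambda>x. if c x = 0 then f x else g x)"
proof -
  have "recursive (\<lambda>x. rec_nat (f x) (\<lambda>_ _. g x) (c x))"
    by (rule recursive_rec_nat[where s="\<lambda>x k r. g x"])
      (auto simp: recursive2_def recursive3_def
        intro!: recursive_intros assms recursive_compose[OF assms(3)])
  moreover have "rec_nat a (\<lambda>_ _. b) m = (if m = 0 then a else b)" for a b m :: nat
    by (cases m) auto
  ultimately show ?thesis by simp
qed

section \<open>Elimination of oracles\<close>

lemma partrec_recursive: "recursive f \<Longrightarrow> partrec (\<lambda>p n. Some (f n))"
  by (simp add: recursive_def)

lemma partrec_reindex: "partrec f \<Longrightarrow> recursive g \<Longrightarrow> partrec (\<lambda>p n. f p (g n))"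
  using partrec.comp[of f "\<lambda>p n. Some (g n)"] by (simp add: recursive_def)

text \<open>Induction on the program: a query becomes a call of \<open>g\<close> at the parameter
  \<open>pfst x\<close>, and every other construction has to carry this parameter along.\<close>

lemma partrec_substitute_oracle:
  assumes "partrec \<Phi>" "recursive2 g"
  shows "partrec (\<lambda>p x. \<Phi> (g (pfst x)) (psnd x))"
  using assms(1)
proof induction
  case query
  then show ?case using assms(2) by (simp add: recursive2_def recursive_def)
next
  case (pair f h)
  from partrec.pair[OF pair.IH] show ?case .
next
  case (comp f h)
  from partrec_bind[OF comp.IH] show ?case by simp
next
  case (prec f h)
  let ?F = "\<lambda>p x. f (g (pfst x)) (psnd x)"
  let ?H = "\<lambda>p x. h (g (pfst x)) (psnd x)"
  \<comment> \<open>Recursion keeps only the first component of its input fixed, so parameter a and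
    argument n are packed into it: inputs are re-associated between \<open>((a, n), m)\<close> and
    \<open>(a, (n, m))\<close>. Minimisation uses the same device.\<close>
  have "partrec (\<lambda>p n. ?H p (prod_encode (pfst (pfst n), prod_encode (psnd (pfst n), psnd n))))"
    by (rule partrec_reindex[OF prec.IH(2)]) (intro recursive_intros)
  from partrec.prec[OF prec.IH(1) this]
  have "partrec (\<lambda>p n. rec_nat (?F p (pfst n))
      (\<lambda>k r. Option.bind r (\<lambda>y. h (g (pfst (pfst n))) (prod_encode (psnd (pfst n), prod_encode (k, y)))))
      (psnd n))"
    by (simp add: case_prod_beta)
  then have "partrec (\<lambda>p n. (\<lambda>n. rec_nat (?F p (pfst n))
      (\<lambda>k r. Option.bind r (\<lambda>y. h (g (pfst (pfst n))) (prod_encode (psnd (pfst n), prod_encode (k, y)))))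
      (psnd n)) (prod_encode (prod_encode (pfst n, pfst (psnd n)), psnd (psnd n))))"
    by (rule partrec_reindex) (intro recursive_intros)
  then show ?case by (simp add: case_prod_beta)
next
  case (mu f)
  let ?F = "\<lambda>p x. f (g (pfst x)) (psnd x)"
  have "partrec (\<lambda>p n. ?F p (prod_encode (pfst (pfst n), prod_encode (psnd (pfst n), psnd n))))"
    by (rule partrec_reindex[OF mu.IH]) (intro recursive_intros)
  from partrec.mu[OF this] show ?case by (simp cong: if_cong)
qed (auto intro!: partrec_recursive recursive_intros)

text \<open>Feeding the names \<open>g a\<close> to the witnessing functional makes it total, and
  the oracle can then be replaced by the recursive \<open>g\<close>. The result is one recursive
  function delivering names uniformly in the parameter.\<close>

lemma computable_family_recursive:
  assumes "computable_family \<delta> \<delta>' x" "recursive2 g" "\<And>a. \<delta> (g a) (h a)"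
  obtains q where "recursive2 q" "\<And>a. \<delta>' (h a) (q a) (x (h a))"
proof -
  obtain \<Phi> where \<Phi>: "partrec \<Phi>" "\<And>p i. \<delta> p i \<Longrightarrow> \<exists>q. computes \<Phi> p q \<and> \<delta>' i q (x i)"
    using assms(1) unfolding computable_family_def by blast
  define q where "q a n = the (\<Phi> (g a) n)" for a n
  have q: "(\<forall>n. \<Phi> (g a) n = Some (q a n)) \<and> \<delta>' (h a) (q a) (x (h a))" for a
  proof -
    obtain r where r: "computes \<Phi> (g a) r" "\<delta>' (h a) r (x (h a))"
      using \<Phi>(2)[OF assms(3)] by blast
    moreover have "r = q a" using r(1) by (auto simp: computes_def q_def)
    ultimately show ?thesis by (auto simp: computes_def)
  qed
  have "recursive2 q"
    using partrec_substitute_oracle[OF \<Phi>(1) assms(2)] q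
    by (simp add: recursive2_def recursive_def)
  with q show ?thesis using that by blast
qed

lemma computable_on_nat:
  assumes "computable_family nat_rep \<delta>' x"
  obtains q where "recursive2 q" "\<And>a. \<delta>' a (q a) (x a)"
proof -
  have "recursive2 (\<lambda>a k. a)" unfolding recursive2_def by (intro recursive_intros)
  from computable_family_recursive[OF assms this, of id] that show ?thesis
    by (auto simp: nat_rep_def)
qed

lemma computable_on_nat_pairs:
  assumes "computable_family (prod_rep nat_rep nat_rep) \<delta>' x"
  obtains q where "recursive2 q" "\<And>i j. \<delta>' (i, j) (q (prod_encode (i, j))) (x (i, j))"
proof -
  \<comment> \<open>Only entries 0 and 1 matter: \<open>prod_rep\<close> interleaves its components
    at even and odd positions, and \<open>nat_rep\<close> reads just the first entry of
    each.\<close>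
  have *: "recursive2 (\<lambda>a k. if k = 0 then pfst a else psnd a)"
    unfolding recursive2_def by (intro recursive_intros)
  obtain q where q: "recursive2 q" "\<And>a. \<delta>' (prod_decode a) (q a) (x (prod_decode a))"
    by (rule computable_family_recursive[OF assms *, of prod_decode])
      (auto simp: nat_rep_def prod_rep_def)
  show ?thesis
    by (rule that[OF q(1)]) (use q(2)[of "prod_encode (i, j)" for i j] in simp)
qed

lemma computable_on_nat_triples:
  assumes "computable_family (prod_rep nat_rep (prod_rep nat_rep nat_rep)) \<delta>' x"
  obtains q where "recursive2 q"
    "\<And>i j k. \<delta>' (i, j, k) (q (prod_encode (i, prod_encode (j, k)))) (x (i, j, k))"
proof -
  \<comment> \<open>Unfolding the two nested interleavings, the three numbers are read at positions
    0, 1 and 3.\<close>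
  have *: "recursive2 (\<lambda>a k. if k = 0 then pfst a else if k - 1 = 0 then pfst (psnd a) else psnd (psnd a))"
    unfolding recursive2_def by (intro recursive_intros)
  let ?h = "\<lambda>a. (pfst a, pfst (psnd a), psnd (psnd a))"
  obtain q where q: "recursive2 q" "\<And>a. \<delta>' (?h a) (q a) (x (?h a))"
    by (rule computable_family_recursive[OF assms *, of ?h])
      (auto simp: nat_rep_def prod_rep_def)
  show ?thesis
    by (rule that[OF q(1)]) (use q(2)[of "prod_encode (i, prod_encode (j, k))" for i j k] in simp)
qed

section \<open>Hilbert spaces\<close>

context hilbert_space
begin

abbreviation rinner :: "'a \<Rightarrow> 'a \<Rightarrow> real" where
  "rinner x y \<equiv> Re (hinner H x y)"

lemma real_scalar: "complex_of_real r \<in> K"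
  using scalars by auto

lemma zero_scalar: "0 \<in> K" and minus_one_scalar: "-1 \<in> K"
  using real_scalar[of 0] real_scalar[of "-1"] by auto

lemma scale_zero: "x \<in> hcarrier H \<Longrightarrow> hscale H 0 x = 0"
  using scale_add_left[of 0 0 x] zero_scalar by simp

lemma scale_minus_one:
  assumes "x \<in> hcarrier H" shows "hscale H (- 1) x = - x"
proof -
  have "hscale H (-1 + 1) x = hscale H (-1) x + hscale H 1 x"
    using real_scalar[of 1] by (intro scale_add_left minus_one_scalar) (auto simp: assms)
  then show ?thesis using assms by (simp add: scale_zero scale_one eq_neg_iff_add_eq_0)
qed

lemma minus_closed: "x \<in> hcarrier H \<Longrightarrow> - x \<in> hcarrier H"
  using scale_closed[OF minus_one_scalar] scale_minus_one by metis

lemma diff_closed: "x \<in> hcarrier H \<Longrightarrow> y \<in> hcarrier H \<Longrightarrow> x - y \<in> hcarrier H"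
  using add_closed[OF _ minus_closed] by fastforce

lemma sum_closed: "(\<And>i. i \<in> I \<Longrightarrow> f i \<in> hcarrier H) \<Longrightarrow> sum f I \<in> hcarrier H"
  by (induction I rule: infinite_finite_induct) (auto simp: zero_closed add_closed)

lemmas closed = zero_closed add_closed minus_closed diff_closed scale_closed sum_closed

lemma inner_minus:
  "x \<in> hcarrier H \<Longrightarrow> y \<in> hcarrier H \<Longrightarrow> hinner H (- x) y = - hinner H x y"
  using inner_scale[OF minus_one_scalar] by (simp add: scale_minus_one)

lemma inner_diff:
  "x \<in> hcarrier H \<Longrightarrow> y \<in> hcarrier H \<Longrightarrow> z \<in> hcarrier H \<Longrightarrow>
    hinner H (x - y) z = hinner H x z - hinner H y z"
  using inner_add[of x "- y" z] by (simp add: minus_closed inner_minus)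

lemma inner_zero: "y \<in> hcarrier H \<Longrightarrow> hinner H 0 y = 0"
  using inner_add[of 0 0 y] by (simp add: zero_closed)

lemma inner_add_right:
  "x \<in> hcarrier H \<Longrightarrow> y \<in> hcarrier H \<Longrightarrow> z \<in> hcarrier H \<Longrightarrow>
    hinner H z (x + y) = hinner H z x + hinner H z y"
  by (metis add_closed complex_cnj_add inner_add inner_commute)

lemma inner_diff_right:
  "x \<in> hcarrier H \<Longrightarrow> y \<in> hcarrier H \<Longrightarrow> z \<in> hcarrier H \<Longrightarrow>
    hinner H z (x - y) = hinner H z x - hinner H z y"
  by (metis diff_closed complex_cnj_diff inner_diff inner_commute)

lemma inner_scale_right:
  "c \<in> K \<Longrightarrow> x \<in> hcarrier H \<Longrightarrow> y \<in> hcarrier H \<Longrightarrow>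
    hinner H x (hscale H c y) = cnj c * hinner H x y"
  by (metis scale_closed complex_cnj_mult inner_scale inner_commute)

lemma rinner_commute: "x \<in> hcarrier H \<Longrightarrow> y \<in> hcarrier H \<Longrightarrow> rinner x y = rinner y x"
  by (simp add: inner_commute[of x y])

lemma hnorm_sq: "x \<in> hcarrier H \<Longrightarrow> (hnorm H x)\<^sup>2 = rinner x x"
  by (simp add: hnorm_def inner_nonneg)

lemma hnorm_nonneg: "x \<in> hcarrier H \<Longrightarrow> 0 \<le> hnorm H x"
  by (simp add: hnorm_def inner_nonneg)

lemma inner_self: "x \<in> hcarrier H \<Longrightarrow> hinner H x x = complex_of_real ((hnorm H x)\<^sup>2)"
  using inner_commute[of x x] by (simp add: hnorm_sq complex_eq_iff)

lemma hnorm_zero [simp]: "hnorm H 0 = 0"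
  by (simp add: hnorm_def inner_zero zero_closed)

lemma hnorm_eq_0: "x \<in> hcarrier H \<Longrightarrow> hnorm H x = 0 \<Longrightarrow> x = 0"
  using inner_definite inner_self by fastforce

lemma hnorm_add_sq:
  "x \<in> hcarrier H \<Longrightarrow> y \<in> hcarrier H \<Longrightarrow>
    (hnorm H (x + y))\<^sup>2 = (hnorm H x)\<^sup>2 + 2 * rinner x y + (hnorm H y)\<^sup>2"
  by (simp add: hnorm_sq closed inner_add inner_add_right rinner_commute[of y x])

lemma hnorm_diff_sq:
  "x \<in> hcarrier H \<Longrightarrow> y \<in> hcarrier H \<Longrightarrow>
    (hnorm H (x - y))\<^sup>2 = (hnorm H x)\<^sup>2 - 2 * rinner x y + (hnorm H y)\<^sup>2"
  by (simp add: hnorm_sq closed inner_diff inner_diff_right rinner_commute[of y x])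

lemma hnorm_scale:
  assumes "c \<in> K" "x \<in> hcarrier H"
  shows "hnorm H (hscale H c x) = cmod c * hnorm H x"
proof -
  have "hinner H (hscale H c x) (hscale H c x) = (c * cnj c) * hinner H x x"
    using assms by (simp add: inner_scale inner_scale_right closed)
  also have "\<dots> = complex_of_real ((cmod c)\<^sup>2 * (hnorm H x)\<^sup>2)"
    using assms by (simp add: inner_self flip: complex_norm_square)
  finally have "(hnorm H (hscale H c x))\<^sup>2 = (cmod c * hnorm H x)\<^sup>2"
    using assms by (simp add: hnorm_sq[of "hscale H c x"] closed power_mult_distrib)
  then show ?thesis
    using assms by (auto intro!: power2_eq_imp_eq hnorm_nonneg closed mult_nonneg_nonneg)
qed

lemma hnorm_minus: "x \<in> hcarrier H \<Longrightarrow> hnorm H (- x) = hnorm H x"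
  using hnorm_scale[OF minus_one_scalar] by (simp add: scale_minus_one)

lemma cauchy_schwarz:
  assumes x: "x \<in> hcarrier H" and y: "y \<in> hcarrier H"
  shows "\<bar>rinner x y\<bar> \<le> hnorm H x * hnorm H y"
proof (cases "hnorm H y = 0")
  case True
  then have "y = 0" using y hnorm_eq_0 by blast
  then show ?thesis using x inner_zero[of x] inner_commute[of x 0] by (simp add: zero_closed)
next
  case False
  \<comment> \<open>The real multiple \<open>t\<close> of \<open>y\<close> that lies closest to
    \<open>x\<close>; the inequality is that the squared norm of the remainder is
    nonnegative.\<close>
  define t where "t = rinner x y / (hnorm H y)\<^sup>2"
  let ?y = "hscale H (complex_of_real t) y"
  have "(hnorm H (x - ?y))\<^sup>2 = (hnorm H x)\<^sup>2 - 2 * (t * rinner x y) + t\<^sup>2 * (hnorm H y)\<^sup>2"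
    using x y by (simp add: hnorm_diff_sq closed real_scalar hnorm_scale inner_scale_right
      power_mult_distrib)
  also have "t\<^sup>2 * (hnorm H y)\<^sup>2 = t * rinner x y"
    using False by (simp add: t_def power2_eq_square)
  finally have "t * rinner x y \<le> (hnorm H x)\<^sup>2"
    using zero_le_power2[of "hnorm H (x - ?y)"] by linarith
  then have "(rinner x y)\<^sup>2 \<le> (hnorm H x * hnorm H y)\<^sup>2"
    using False by (simp add: t_def power_mult_distrib power2_eq_square[of "rinner x y"] pos_divide_le_eq)
  then have "\<bar>rinner x y\<bar> \<le> \<bar>hnorm H x * hnorm H y\<bar>" by (simp add: abs_le_square_iff)
  then show ?thesis using x y by (simp add: hnorm_nonneg)
qed

lemma hnorm_triangle:
  assumes "x \<in> hcarrier H" "y \<in> hcarrier H"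
  shows "hnorm H (x + y) \<le> hnorm H x + hnorm H y"
proof (rule power2_le_imp_le)
  show "(hnorm H (x + y))\<^sup>2 \<le> (hnorm H x + hnorm H y)\<^sup>2"
    using cauchy_schwarz[OF assms] by (simp add: hnorm_add_sq assms power2_sum)
qed (simp add: assms hnorm_nonneg)

lemma hnorm_sum_le:
  "(\<And>i. i \<in> I \<Longrightarrow> f i \<in> hcarrier H) \<Longrightarrow> hnorm H (sum f I) \<le> (\<Sum>i\<in>I. hnorm H (f i))"
proof (induction I rule: infinite_finite_induct)
  case (insert i I)
  then show ?case
    using hnorm_triangle[of "f i" "sum f I"] by (simp add: closed)
qed simp_all

lemma hdist_self [simp]: "hdist H x x = 0"
  by (simp add: hdist_def)

lemma hdist_zero_right [simp]: "hdist H x 0 = hnorm H x"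
  by (simp add: hdist_def)

lemma hdist_nonneg: "x \<in> hcarrier H \<Longrightarrow> y \<in> hcarrier H \<Longrightarrow> 0 \<le> hdist H x y"
  by (simp add: hdist_def hnorm_nonneg closed)

lemma hdist_commute: "x \<in> hcarrier H \<Longrightarrow> y \<in> hcarrier H \<Longrightarrow> hdist H x y = hdist H y x"
  using hnorm_minus[of "x - y"] by (simp add: hdist_def closed)

lemma hdist_triangle:
  "x \<in> hcarrier H \<Longrightarrow> y \<in> hcarrier H \<Longrightarrow> z \<in> hcarrier H \<Longrightarrow>
    hdist H x z \<le> hdist H x y + hdist H y z"
  using hnorm_triangle[of "x - y" "y - z"] by (simp add: hdist_def closed)

lemma hnorm_diff_le:
  assumes "x \<in> hcarrier H" "y \<in> hcarrier H"
  shows "\<bar>hnorm H x - hnorm H y\<bar> \<le> hdist H x y"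
  using hdist_triangle[of x y 0] hdist_triangle[of y x 0] hdist_commute[of x y] assms
  by (simp add: zero_closed)

lemma inner_eqI:
  assumes "x \<in> hcarrier H" "y \<in> hcarrier H"
    and "\<And>z. z \<in> hcarrier H \<Longrightarrow> rinner z x = rinner z y"
  shows "x = y"
proof -
  have "rinner (x - y) (x - y) = 0"
    using assms(3)[of "x - y"] assms by (simp add: inner_diff_right closed)
  then have "hnorm H (x - y) = 0" by (simp add: hnorm_def)
  then show ?thesis using hnorm_eq_0[of "x - y"] assms by (simp add: closed)
qed

text \<open>Over the reals the imaginary parts vanish. Over the complex numbers they are recovered
  by testing the real parts at \<open>hscale H \<i> x\<close>.\<close>

lemma rinner_eq_imp_inner_eq:
  assumes "\<And>c x. c \<in> K \<Longrightarrow> x \<in> hcarrier H \<Longrightarrow> \<phi> (hscale H c x) = c * \<phi> x"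
    and "\<And>x. x \<in> hcarrier H \<Longrightarrow> \<phi> x \<in> K"
    and "z \<in> hcarrier H" and re: "\<And>x. x \<in> hcarrier H \<Longrightarrow> rinner x z = Re (\<phi> x)"
    and "x \<in> hcarrier H"
  shows "hinner H x z = \<phi> x"
  using scalars
proof
  assume "K = \<real>"
  then have "Im (hinner H x z) = 0" "Im (\<phi> x) = 0"
    using inner_scalar[of x z] assms by (auto simp: complex_is_Real_iff)
  then show ?thesis using re[of x] assms by (simp add: complex_eq_iff)
next
  assume "K = UNIV"
  then have "Im (hinner H x z) = Im (\<phi> x)"
    using re[of "hscale H \<i> x"] assms scale_closed[of \<i> x] inner_scale[of \<i> x z] by simp
  then show ?thesis using re[of x] assms by (simp add: complex_eq_iff)
qed

text \<open>
  The representing vector minimises \<open>J x = \<parallel>x\<parallel>\<^sup>2 - 2 Re (\<phi> x)\<close>; minimising sequences are Cauchy by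
  the parallelogram law.
\<close>

lemma riesz_representation:
  assumes add: "\<And>x y. x \<in> hcarrier H \<Longrightarrow> y \<in> hcarrier H \<Longrightarrow> \<phi> (x + y) = \<phi> x + \<phi> y"
    and scale: "\<And>c x. c \<in> K \<Longrightarrow> x \<in> hcarrier H \<Longrightarrow> \<phi> (hscale H c x) = c * \<phi> x"
    and scalar: "\<And>x. x \<in> hcarrier H \<Longrightarrow> \<phi> x \<in> K"
    and bound: "\<And>x. x \<in> hcarrier H \<Longrightarrow> Re (\<phi> x) \<le> M * hnorm H x"
  obtains z where "z \<in> hcarrier H" "\<And>x. x \<in> hcarrier H \<Longrightarrow> hinner H x z = \<phi> x"
proof -
  define J where "J x = (hnorm H x)\<^sup>2 - 2 * Re (\<phi> x)" for x
  have re_scale: "Re (\<phi> (hscale H (complex_of_real t) x)) = t * Re (\<phi> x)" if "x \<in> hcarrier H" for t x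
    using scale[OF real_scalar that] by simp
  \<comment> \<open>Completing the square in the norm of \<open>x\<close>; boundedness of \<phi> is
    what makes the infimum \<open>m\<close> meaningful.\<close>
  have J_lower: "- M\<^sup>2 \<le> J x" if "x \<in> hcarrier H" for x
  proof -
    have "0 \<le> (hnorm H x - M)\<^sup>2" by simp
    also have "\<dots> = (hnorm H x)\<^sup>2 - 2 * (M * hnorm H x) + M\<^sup>2" by (simp add: power2_diff)
    finally show ?thesis using bound[OF that] by (simp add: J_def)
  qed
  define m where "m = (INF x\<in>hcarrier H. J x)"
  have bdd: "bdd_below (J ` hcarrier H)" by (rule bdd_belowI2[of _ "- M\<^sup>2"]) (rule J_lower)
  have m_le: "m \<le> J x" if "x \<in> hcarrier H" for x
    unfolding m_def by (rule cINF_lower[OF bdd that])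
  have "\<exists>x\<in>hcarrier H. J x < m + 1 / (real n + 1)" for n
  proof -
    have "m < m + 1 / (real n + 1)" by simp
    then show ?thesis unfolding m_def using cINF_less_iff[OF _ bdd] zero_closed by blast
  qed
  then obtain X where X: "\<And>n. X n \<in> hcarrier H" and XJ: "\<And>n. J (X n) < m + 1 / (real n + 1)"
    by metis
  \<comment> \<open>The midpoint of \<open>x\<close> and \<open>y\<close> cannot push J below
    \<open>m\<close>; by the parallelogram law this bounds their distance.\<close>
  have gap: "(hdist H x y)\<^sup>2 \<le> 2 * (J x - m) + 2 * (J y - m)"
    if x: "x \<in> hcarrier H" and y: "y \<in> hcarrier H" for x y
  proof -
    let ?w = "hscale H (complex_of_real (1/2)) (x + y)"
    have "m \<le> J ?w" by (intro m_le closed x y real_scalar)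
    also have "J ?w = (hnorm H (x + y))\<^sup>2 / 4 - (Re (\<phi> x) + Re (\<phi> y))"
      using x y unfolding J_def
      by (subst re_scale, simp add: closed, subst hnorm_scale[OF real_scalar])
         (simp_all add: closed add power_divide diff_divide_distrib add_divide_distrib)
    finally have "4 * m \<le> (hnorm H (x + y))\<^sup>2 - 4 * (Re (\<phi> x) + Re (\<phi> y))" by simp
    moreover have "(hnorm H (x + y))\<^sup>2 + (hdist H x y)\<^sup>2 = 2 * (hnorm H x)\<^sup>2 + 2 * (hnorm H y)\<^sup>2"
      using x y by (simp add: hdist_def hnorm_add_sq hnorm_diff_sq)
    ultimately show ?thesis by (simp add: J_def)
  qed
  have small: "\<exists>N. \<forall>n\<ge>N. 1 / (real n + 1) < \<epsilon>" if "\<epsilon> > 0" for \<epsilon> :: real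
  proof -
    obtain N where N: "inverse (real (Suc N)) < \<epsilon>" using reals_Archimedean[OF \<open>\<epsilon> > 0\<close>] by blast
    have "1 / (real n + 1) < \<epsilon>" if "n \<ge> N" for n
    proof -
      have "1 / (real n + 1) \<le> 1 / (real N + 1)" using that by (intro divide_left_mono) auto
      then show ?thesis using N by (simp add: inverse_eq_divide add.commute)
    qed
    then show ?thesis by blast
  qed
  have "\<exists>N. \<forall>i\<ge>N. \<forall>j\<ge>N. hdist H (X i) (X j) < \<epsilon>" if "\<epsilon> > 0" for \<epsilon>
  proof -
    obtain N where N: "\<And>n. n \<ge> N \<Longrightarrow> 1 / (real n + 1) < \<epsilon>\<^sup>2 / 4"
      using small[of "\<epsilon>\<^sup>2 / 4"] \<open>\<epsilon> > 0\<close> by auto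
    have close: "J (X i) < m + \<epsilon>\<^sup>2 / 4" if "i \<ge> N" for i
      by (rule less_trans[OF XJ add_strict_left_mono[OF N[OF that]]])
    have "hdist H (X i) (X j) < \<epsilon>" if "i \<ge> N" "j \<ge> N" for i j
    proof (rule power2_less_imp_less)
      show "(hdist H (X i) (X j))\<^sup>2 < \<epsilon>\<^sup>2"
        using gap[OF X X, of i j] close[OF that(1)] close[OF that(2)] by argo
    qed (use \<open>\<epsilon> > 0\<close> in simp)
    then show ?thesis by blast
  qed
  from complete[OF X this] obtain z where z: "z \<in> hcarrier H" "(\<lambda>n. hdist H (X n) z) \<longlonglongrightarrow> 0" by blast
  have Jz: "J z \<le> m"
  proof -
    have lim1: "(\<lambda>n. hnorm H (X n)) \<longlonglongrightarrow> hnorm H z"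
      by (rule LIM_zero_cancel, rule tendsto_0_le[OF z(2), where K=1])
        (use hnorm_diff_le[OF X z(1)] in \<open>auto intro!: always_eventually order_trans[OF _ abs_ge_self]\<close>)
    \<comment> \<open>The one-sided bound on \<phi>, applied to \<open>X n - z\<close>, bounds the
      real part at \<open>z\<close> from below, which is the direction that
      \<open>J z \<le> m\<close> requires.\<close>
    have re_le: "Re (\<phi> (X n)) - M * hdist H (X n) z \<le> Re (\<phi> z)" for n
    proof -
      have "Re (\<phi> (X n)) = Re (\<phi> z) + Re (\<phi> (X n - z))"
        using add[OF z(1) diff_closed[OF X z(1)], of n] by simp
      then show ?thesis using bound[OF diff_closed[OF X z(1)], of n] by (simp add: hdist_def)
    qed
    have "(\<lambda>n. m + 1 / (real n + 1) - (hnorm H (X n))\<^sup>2 + (hnorm H z)\<^sup>2 + 2 * (M * hdist H (X n) z)) 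
        \<longlonglongrightarrow> m + 0 - (hnorm H z)\<^sup>2 + (hnorm H z)\<^sup>2 + 2 * (M * 0)"
      using LIMSEQ_inverse_real_of_nat
      by (intro tendsto_intros lim1 z(2)) (simp add: inverse_eq_divide add.commute)
    then have "(\<lambda>n. m + 1 / (real n + 1) - (hnorm H (X n))\<^sup>2 + (hnorm H z)\<^sup>2 + 2 * (M * hdist H (X n) z)) \<longlonglongrightarrow> m"
      by simp
    moreover have "J z \<le> m + 1 / (real n + 1) - (hnorm H (X n))\<^sup>2 + (hnorm H z)\<^sup>2 + 2 * (M * hdist H (X n) z)" for n
      using XJ[of n] re_le[of n] unfolding J_def by argo
    ultimately show ?thesis by (intro LIMSEQ_le_const) auto
  qed
  have "rinner x z = Re (\<phi> x)" if x: "x \<in> hcarrier H" for x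
  proof -
    define d where "d = rinner x z - Re (\<phi> x)"
    have ineq: "0 \<le> 2 * t * d + t\<^sup>2 * (hnorm H x)\<^sup>2" for t
    proof -
      let ?x = "hscale H (complex_of_real t) x"
      have "J z \<le> J (z + ?x)" using Jz m_le[of "z + ?x"] x z(1) by (simp add: closed real_scalar)
      also have "J (z + ?x) = J z + (2 * t * d + t\<^sup>2 * (hnorm H x)\<^sup>2)"
        using x z(1) unfolding J_def d_def
        by (simp add: add closed real_scalar re_scale hnorm_add_sq hnorm_scale inner_scale_right
            power_mult_distrib rinner_commute[of z x] algebra_simps)
      finally show ?thesis by simp
    qed
    \<comment> \<open>The best perturbation would be \<open>- d\<close> divided by the squared norm
      of \<open>x\<close>; adding 1 covers the case \<open>x = 0\<close> and still leaves a decrease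
      unless \<open>d = 0\<close>.\<close>
    define s where "s = (hnorm H x)\<^sup>2 + 1"
    have s: "s > 0" "(hnorm H x)\<^sup>2 < s" by (auto simp: s_def add_nonneg_pos)
    have "2 * (- d / s) * d + (- d / s)\<^sup>2 * (hnorm H x)\<^sup>2 \<le> - (d\<^sup>2 / s)"
    proof -
      have "(- d / s)\<^sup>2 * (hnorm H x)\<^sup>2 \<le> (- d / s)\<^sup>2 * s" using s by (intro mult_left_mono) auto
      also have "\<dots> = d\<^sup>2 / s" using s by (simp add: power2_eq_square)
      finally show ?thesis by (simp add: power2_eq_square)
    qed
    with ineq[of "- d / s"] have "d\<^sup>2 / s \<le> 0" by linarith
    then have "d = 0" using s by (simp add: divide_le_0_iff)
    then show ?thesis by (simp add: d_def)
  qed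
  then have "hinner H x z = \<phi> x" if "x \<in> hcarrier H" for x
    using rinner_eq_imp_inner_eq[of \<phi>, OF scale scalar z(1) _ that] by blast
  with z(1) show ?thesis using that by blast
qed

section \<open>Orthonormal expansions\<close>

lemma hspan_range:
  fixes e :: "nat \<Rightarrow> 'a"
  assumes "range e \<subseteq> hcarrier H" "s \<in> hspan K H (range e)"
  obtains N c where "\<And>k. c k \<in> K" "s = (\<Sum>k<N. hscale H (c k) (e k))"
proof -
  obtain F c where F: "finite F" "F \<subseteq> range e" "\<And>s. s \<in> F \<Longrightarrow> c s \<in> K"
    and s: "s = (\<Sum>s\<in>F. hscale H (c s) s)"
    using assms(2) unfolding hspan_def by blast
  \<comment> \<open>\<open>hspan\<close> sums over a set of vectors and \<open>e\<close> may repeat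
    values, so each vector is given exactly one index; the remaining indices get coefficient
    0.\<close>
  obtain I where I: "inj_on e I" "F = e ` I" using F(2) unfolding subset_image_inj by blast
  have "finite I" using F(1) I finite_imageD by blast
  then obtain N where N: "I \<subseteq> {..<N}" using finite_nat_iff_bounded by blast
  define c' where "c' k = (if k \<in> I then c (e k) else 0)" for k
  have "s = (\<Sum>k\<in>I. hscale H (c' k) (e k))"
    unfolding s I(2) by (simp add: sum.reindex[OF I(1)] c'_def)
  also have "\<dots> = (\<Sum>k<N. hscale H (c' k) (e k))"
    using assms(1) N by (intro sum.mono_neutral_left) (auto simp: c'_def intro!: scale_zero)
  finally show ?thesis
    by (rule that[rotated]) (use F(3) I(2) zero_scalar in \<open>auto simp: c'_def\<close>)
qed

text \<open>One identity for two purposes: with the Fourier coefficients for \<open>c\<close> the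
  last sum vanishes and Bessel's inequality results; for any other \<open>c\<close> it shows how
  much is lost against the best approximation.\<close>

lemma orthonormal_approx:
  fixes b :: "nat \<Rightarrow> 'a"
  assumes b: "range b \<subseteq> hcarrier H" "\<And>i j. hinner H (b i) (b j) = (if i = j then 1 else 0)"
    and c: "\<And>k. c k \<in> K" and y: "y \<in> hcarrier H"
  shows "(hnorm H (y - (\<Sum>k<N. hscale H (c k) (b k))))\<^sup>2 =
    (hnorm H y)\<^sup>2 - (\<Sum>k<N. (cmod (hinner H y (b k)))\<^sup>2) + (\<Sum>k<N. (cmod (c k - hinner H y (b k)))\<^sup>2)"
proof (induction N)
  case (Suc N)
  let ?S = "\<lambda>N. \<Sum>k<N. hscale H (c k) (b k)"
  have bc: "b k \<in> hcarrier H" for k using b(1) by auto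
  have S: "?S n \<in> hcarrier H" for n by (intro closed c bc)
  \<comment> \<open>Partial sums are orthogonal to all later basis vectors, so the remainder has the
    same coefficient at \<open>b N\<close> as \<open>y\<close> itself.\<close>
  have orth: "hinner H (?S n) (b k) = 0" if "n \<le> k" for n k
    using that
  proof (induction n)
    case (Suc n)
    have "hscale H (c n) (b n) \<in> hcarrier H" by (intro closed c bc)
    with Suc show ?case by (simp add: inner_add[OF S _ bc] inner_scale[OF c bc bc] b(2))
  qed (simp add: inner_zero bc)
  let ?r = "y - ?S N"
  have r: "?r \<in> hcarrier H" by (intro closed y c bc)
  have "hinner H ?r (b N) = hinner H y (b N)"
    by (simp add: inner_diff[OF y S bc] orth)
  moreover have "hnorm H (b N) = 1" using b(2)[of N N] by (simp add: hnorm_def)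
  ultimately have "(hnorm H (?r - hscale H (c N) (b N)))\<^sup>2 =
      (hnorm H ?r)\<^sup>2 - 2 * Re (cnj (c N) * hinner H y (b N)) + (cmod (c N))\<^sup>2"
    by (simp add: hnorm_diff_sq r closed c bc hnorm_scale inner_scale_right)
  \<comment> \<open>Completing the square in the complex number \<open>c N\<close>.\<close>
  also have "\<dots> = (hnorm H ?r)\<^sup>2 + (cmod (c N - hinner H y (b N)))\<^sup>2 - (cmod (hinner H y (b N)))\<^sup>2"
    unfolding cmod_power2 by (simp add: power2_eq_square algebra_simps)
  finally show ?case using Suc by (simp add: diff_diff_eq)
qed simp

text \<open>Bessel's inequality bounds the partial sums from above. Density of the span bounds some
  partial sum from below, since the error term of \<open>orthonormal_approx\<close> is nonnegative,
  and monotonicity turns both into convergence.\<close>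

lemma parseval:
  assumes "orthonormal_basis K H b" and y: "y \<in> hcarrier H"
  shows "(\<lambda>k. (cmod (hinner H y (b k)))\<^sup>2) sums (hnorm H y)\<^sup>2"
proof -
  have b: "range b \<subseteq> hcarrier H" "\<And>i j. hinner H (b i) (b j) = (if i = j then 1 else 0)"
    and dense: "hdense H (hspan K H (range b))"
    using assms(1) by (auto simp: orthonormal_basis_def)
  let ?a = "\<lambda>k. (cmod (hinner H y (b k)))\<^sup>2"
  have upper: "sum ?a {..<N} \<le> (hnorm H y)\<^sup>2" for N
    using orthonormal_approx[OF b _ y, of "\<lambda>k. hinner H y (b k)" N] b(1)
      zero_le_power2[of "hnorm H (y - (\<Sum>k<N. hscale H (hinner H y (b k)) (b k)))"]
    by (auto simp: inner_scalar y subset_iff simp del: zero_le_power2)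
  have lower: "\<exists>N. (hnorm H y)\<^sup>2 - \<epsilon> < sum ?a {..<N}" if "\<epsilon> > 0" for \<epsilon>
  proof -
    obtain s where s: "s \<in> hspan K H (range b)" "hdist H y s < sqrt \<epsilon>"
      using dense y \<open>\<epsilon> > 0\<close> unfolding hdense_def by (meson real_sqrt_gt_zero)
    obtain N c where c: "\<And>k. c k \<in> K" "s = (\<Sum>k<N. hscale H (c k) (b k))"
      using hspan_range[OF b(1) s(1)] by metis
    have "s \<in> hcarrier H" using dense s(1) unfolding hdense_def by blast
    then have "(hdist H y s)\<^sup>2 < (sqrt \<epsilon>)\<^sup>2"
      using s(2) hdist_nonneg[OF y] by (intro power_strict_mono) auto
    then have "(hnorm H (y - s))\<^sup>2 < \<epsilon>" using \<open>\<epsilon> > 0\<close> by (simp add: hdist_def)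
    then have "(hnorm H y)\<^sup>2 - sum ?a {..<N} + (\<Sum>k<N. (cmod (c k - hinner H y (b k)))\<^sup>2) < \<epsilon>"
      unfolding c(2) orthonormal_approx[OF b c(1) y] .
    moreover have "0 \<le> (\<Sum>k<N. (cmod (c k - hinner H y (b k)))\<^sup>2)" by (intro sum_nonneg) simp
    ultimately show ?thesis by (intro exI[of _ N]) linarith
  qed
  show ?thesis unfolding sums_def
  proof (rule LIMSEQ_I)
    fix r :: real assume "r > 0"
    from lower[OF this] obtain N where N: "(hnorm H y)\<^sup>2 - r < sum ?a {..<N}" by blast
    have "norm (sum ?a {..<n} - (hnorm H y)\<^sup>2) < r" if "n \<ge> N" for n
    proof -
      have "sum ?a {..<N} \<le> sum ?a {..<n}" using that by (intro sum_mono2) auto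
      then show ?thesis using N upper[of n] by auto
    qed
    then show "\<exists>no. \<forall>n\<ge>no. norm (sum ?a {..<n} - (hnorm H y)\<^sup>2) < r" by blast
  qed
qed

end

text \<open>Gives meaning to the definite description in \<open>hadjoint\<close>: existence is Riesz
  representation of \<open>\<lambda>x. hinner G (T x) y\<close>, uniqueness is
  \<open>inner_eqI\<close>.\<close>

lemma hadjoint_works:
  assumes "hilbert_space K H" "hilbert_space K G" "bounded_operator K H G T" "y \<in> hcarrier G"
  shows "hadjoint H G T y \<in> hcarrier H"
    and "\<And>x. x \<in> hcarrier H \<Longrightarrow> hinner G (T x) y = hinner H x (hadjoint H G T y)"
proof -
  interpret H: hilbert_space K H by fact
  interpret G: hilbert_space K G by fact
  obtain M where T: "\<And>x. x \<in> hcarrier H \<Longrightarrow> T x \<in> hcarrier G"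
    "\<And>x y. x \<in> hcarrier H \<Longrightarrow> y \<in> hcarrier H \<Longrightarrow> T (x + y) = T x + T y"
    "\<And>c x. c \<in> K \<Longrightarrow> x \<in> hcarrier H \<Longrightarrow> T (hscale H c x) = hscale G c (T x)"
    and M: "\<And>x. x \<in> hcarrier H \<Longrightarrow> hnorm G (T x) \<le> M * hnorm H x"
    using assms(3) unfolding bounded_operator_def by blast
  have bound: "Re (hinner G (T x) y) \<le> (M * hnorm G y) * hnorm H x" if "x \<in> hcarrier H" for x
  proof -
    have "Re (hinner G (T x) y) \<le> hnorm G (T x) * hnorm G y"
      using G.cauchy_schwarz[OF T(1)[OF that] assms(4)] by linarith
    also have "\<dots> \<le> (M * hnorm H x) * hnorm G y"
      by (intro mult_right_mono M that G.hnorm_nonneg assms(4))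
    finally show ?thesis by (simp add: algebra_simps)
  qed
  obtain z where z: "z \<in> hcarrier H" "\<And>x. x \<in> hcarrier H \<Longrightarrow> hinner H x z = hinner G (T x) y"
    by (rule H.riesz_representation[where \<phi> = "\<lambda>x. hinner G (T x) y"])
      (auto simp: T assms(4) G.inner_add G.inner_scale G.inner_scalar intro: bound)
  have "hadjoint H G T y = z"
    unfolding hadjoint_def
    by (rule the_equality) (use z in \<open>auto intro!: H.inner_eqI\<close>)
  then show "hadjoint H G T y \<in> hcarrier H"
    and "\<And>x. x \<in> hcarrier H \<Longrightarrow> hinner G (T x) y = hinner H x (hadjoint H G T y)"
    using z by auto
qed

section \<open>Names and rational approximations\<close>

text \<open>Nonnegative terms make the series unconditionally summable, so iterated sums become a
  sum over pairs, which the bijection \<open>prod_decode\<close> lists in one sequence.\<close>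

lemma sums_prod_decode:
  fixes t :: "nat \<times> nat \<Rightarrow> real"
  assumes "\<And>z. 0 \<le> t z" "\<And>i. (\<lambda>j. t (i, j)) sums g i" "summable g"
  shows "(\<lambda>n. t (prod_decode n)) sums suminf g"
proof -
  have t: "((\<lambda>j. t (i, j)) has_sum g i) UNIV" for i
    by (rule sums_nonneg_imp_has_sum) (use assms in auto)
  have g0: "0 \<le> g i" for i using has_sum_nonneg[OF t] assms(1) by blast
  have g: "(g has_sum suminf g) UNIV"
    by (rule sums_nonneg_imp_has_sum[OF summable_sums[OF assms(3)] g0])
  have summable: "t summable_on (UNIV \<times> UNIV)"
    by (rule summable_on_SigmaI[OF t]) (use g assms(1) in \<open>auto simp: summable_on_def\<close>)
  have "(t has_sum suminf g) (UNIV \<times> UNIV)"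
    by (rule has_sum_SigmaI[where g = g]) (use t g summable in auto)
  then have "((\<lambda>n. t (prod_decode n)) has_sum suminf g) UNIV"
    using has_sum_reindex_bij_betw[OF bij_prod_decode, of t] by simp
  then show ?thesis by (rule has_sum_imp_sums)
qed

text \<open>Let the later index tend to infinity in the Cauchy condition. As \<open>d\<close> is a
  bare function, the triangle inequality enters as a hypothesis.\<close>

lemma cauchy_rep_dist:
  assumes "cauchy_rep X d \<alpha> p x"
    and "\<And>m n. d (\<alpha> m) x \<le> d (\<alpha> m) (\<alpha> n) + d (\<alpha> n) x"
  shows "d (\<alpha> (p k)) x \<le> (1/2) ^ k"
proof (rule LIMSEQ_le_const)
  show "(\<lambda>l. (1/2) ^ k + d (\<alpha> (p l)) x) \<longlonglongrightarrow> (1/2) ^ k"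
    using tendsto_add[OF tendsto_const, of "\<lambda>l. d (\<alpha> (p l)) x" 0] assms(1)
    by (simp add: cauchy_rep_def)
  have "d (\<alpha> (p k)) x \<le> (1/2) ^ k + d (\<alpha> (p l)) x" if "l \<ge> Suc k" for l
  proof -
    have "d (\<alpha> (p k)) (\<alpha> (p l)) < (1/2) ^ k" using assms(1) that by (simp add: cauchy_rep_def)
    with assms(2)[of "p k" "p l"] show ?thesis by linarith
  qed
  then show "\<exists>N. \<forall>l\<ge>N. d (\<alpha> (p k)) x \<le> (1/2) ^ k + d (\<alpha> (p l)) x" by blast
qed

lemma real_rep_dist: "real_rep p v \<Longrightarrow> \<bar>rat_enum (p k) - v\<bar> \<le> (1/2) ^ k"
  unfolding real_rep_def using cauchy_rep_dist[of UNIV dist rat_enum p v k]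
  by (auto simp: dist_triangle dist_real_def)

lemma rat_enum_dense:
  assumes "\<epsilon> > 0" shows "\<exists>n. \<bar>rat_enum n - r\<bar> < \<epsilon>"
proof -
  obtain q where q: "q \<in> \<rat>" "r - \<epsilon> < q" "q < r + \<epsilon>"
    using Rats_dense_in_real[of "r - \<epsilon>" "r + \<epsilon>"] assms by auto
  obtain i :: int and n :: nat where "q = real_of_int i / real n" "n \<noteq> 0"
    using q(1) unfolding Rats_eq_int_div_nat by blast
  \<comment> \<open>The sign is coded by a difference of naturals, one of which is 0; denominators
    are stored minus one.\<close>
  then have "rat_enum (prod_encode (prod_encode (nat i, nat (- i)), n - 1)) = q"
    by (cases n) (auto simp: rat_enum_def add.commute)
  moreover have "\<bar>q - r\<bar> < \<epsilon>" using q by (simp add: abs_less_iff)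
  ultimately show ?thesis by metis
qed

section \<open>Density of the enumerations and names of vectors\<close>

context hilbert_space
begin

lemma scalar_enum_closed: "scalar_enum K n \<in> K"
  using scalars by (auto simp: scalar_enum_def)

lemma scalar_enum_dense:
  assumes "c \<in> K" "\<epsilon> > 0" shows "\<exists>n. cmod (scalar_enum K n - c) < \<epsilon>"
proof (cases "K = \<real>")
  case True
  then obtain r where r: "c = complex_of_real r" using assms(1) by (auto elim: Reals_cases)
  obtain n where n: "\<bar>rat_enum n - r\<bar> < \<epsilon>" using rat_enum_dense[OF assms(2)] by blast
  have "cmod (scalar_enum K n - c) < \<epsilon>"
    using n True by (simp add: scalar_enum_def r del: of_real_diff flip: of_real_diff)
  then show ?thesis by blast
next
  case False
  obtain a b where ab: "\<bar>rat_enum a - Re c\<bar> < \<epsilon> / 2" "\<bar>rat_enum b - Im c\<bar> < \<epsilon> / 2"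
    using rat_enum_dense[of "\<epsilon> / 2"] assms(2) by (meson half_gt_zero)
  have "cmod (scalar_enum K (prod_encode (a, b)) - c) \<le> \<bar>rat_enum a - Re c\<bar> + \<bar>rat_enum b - Im c\<bar>"
    using False cmod_le[of "scalar_enum K (prod_encode (a, b)) - c"] by (simp add: scalar_enum_def)
  with ab show ?thesis by (intro exI[of _ "prod_encode (a, b)"]) linarith
qed

lemma scale_diff_left:
  assumes "c \<in> K" "d \<in> K" "x \<in> hcarrier H"
  shows "hscale H (c - d) x = hscale H c x - hscale H d x"
proof -
  have "c - d \<in> K" using scalars assms by auto
  from scale_add_left[OF this assms(2,3)] show ?thesis by simp
qed

lemma lincomb_enum_zero: "lincomb_enum K H e 0 = 0"
  by (simp add: lincomb_enum_def)

context
  fixes e :: "nat \<Rightarrow> 'a"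
  assumes e: "range e \<subseteq> hcarrier H"
begin

lemma lincomb_enum_closed: "lincomb_enum K H e n \<in> hcarrier H"
  using e by (auto simp: lincomb_enum_def Let_def intro!: closed scalar_enum_closed)

lemma lincomb_enum_dense:
  assumes dense: "hdense H (hspan K H (range e))" and x: "x \<in> hcarrier H" and "\<epsilon> > 0"
  shows "\<exists>m. hdist H (lincomb_enum K H e m) x < \<epsilon>"
proof -
  have ec: "e k \<in> hcarrier H" for k using e by auto
  obtain s where s: "s \<in> hspan K H (range e)" "hdist H x s < \<epsilon> / 2"
    using dense x \<open>\<epsilon> > 0\<close> unfolding hdense_def by (meson half_gt_zero)
  obtain N c where c: "\<And>k. c k \<in> K" and s_eq: "s = (\<Sum>k<N. hscale H (c k) (e k))"
    using hspan_range[OF e s(1)] by metis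
  \<comment> \<open>The summand 1 keeps \<open>D\<close> positive when all the vectors vanish and
    makes the final estimate strict.\<close>
  define D where "D = 1 + (\<Sum>k<N. hnorm H (e k))"
  have "D > 0" unfolding D_def by (intro add_pos_nonneg sum_nonneg hnorm_nonneg ec) simp
  define \<eta> where "\<eta> = \<epsilon> / 2 / D"
  have "\<eta> > 0" using \<open>D > 0\<close> \<open>\<epsilon> > 0\<close> by (simp add: \<eta>_def)
  have "\<exists>n. cmod (scalar_enum K n - c k) < \<eta>" for k
    by (rule scalar_enum_dense[OF c \<open>\<eta> > 0\<close>])
  then obtain n where n: "\<And>k. cmod (scalar_enum K (n k) - c k) < \<eta>" by metis
  define m where "m = list_encode (map n [0..<N])"
  have m: "lincomb_enum K H e m = (\<Sum>k<N. hscale H (scalar_enum K (n k)) (e k))"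
    by (simp add: lincomb_enum_def m_def)
  have diff_in: "scalar_enum K (n k) - c k \<in> K" for k
    using scalars c[of k] scalar_enum_closed[of "n k"] by auto
  have "lincomb_enum K H e m - s = (\<Sum>k<N. hscale H (scalar_enum K (n k) - c k) (e k))"
    by (simp add: m s_eq scale_diff_left c scalar_enum_closed ec flip: sum_subtractf)
  then have "hdist H (lincomb_enum K H e m) s \<le> (\<Sum>k<N. hnorm H (hscale H (scalar_enum K (n k) - c k) (e k)))"
    unfolding hdist_def by (simp only:) (intro hnorm_sum_le closed diff_in ec)
  also have "\<dots> \<le> (\<Sum>k<N. \<eta> * hnorm H (e k))"
    by (intro sum_mono)
      (auto simp: hnorm_scale diff_in ec hnorm_nonneg intro!: mult_right_mono less_imp_le[OF n])
  also have "\<dots> < \<eta> * D"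
    using \<open>\<eta> > 0\<close> by (simp add: D_def sum_distrib_left algebra_simps)
  also have "\<eta> * D = \<epsilon> / 2" using \<open>D > 0\<close> by (simp add: \<eta>_def)
  finally have "hdist H (lincomb_enum K H e m) s < \<epsilon> / 2" .
  moreover have sc: "s \<in> hcarrier H" using dense s(1) unfolding hdense_def by blast
  ultimately have "hdist H (lincomb_enum K H e m) x < \<epsilon>"
    using hdist_triangle[OF lincomb_enum_closed sc x, of m] hdist_commute[OF sc x] s(2) by linarith
  then show ?thesis by blast
qed

lemma hilbert_rep_dist:
  "hilbert_rep K H e p x \<Longrightarrow> hdist H (lincomb_enum K H e (p k)) x \<le> (1/2) ^ k"
  unfolding hilbert_rep_def
  by (rule cauchy_rep_dist, assumption)
    (intro hdist_triangle lincomb_enum_closed, simp add: cauchy_rep_def)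

text \<open>Makes operator names usable at dense points: every prefix of such a name is a list of
  copies of \<open>m\<close>.\<close>

lemma hilbert_rep_const: "hilbert_rep K H e (\<lambda>_. m) (lincomb_enum K H e m)"
  by (simp add: hilbert_rep_def cauchy_rep_def lincomb_enum_closed)

text \<open>The spare factor 1/2 pays for two errors: those at positions \<open>k < l\<close>
  together stay below \<open>(1/2) ^ k\<close>.\<close>

lemma hilbert_repI:
  assumes x: "x \<in> hcarrier H" and p: "\<And>k. hdist H (lincomb_enum K H e (p k)) x < (1/2) ^ Suc k"
  shows "hilbert_rep K H e p x"
  unfolding hilbert_rep_def cauchy_rep_def
proof (intro conjI allI impI)
  fix k l :: nat assume "k < l"
  have "hdist H (lincomb_enum K H e (p k)) (lincomb_enum K H e (p l)) <
      (1/2) ^ Suc k + (1/2) ^ Suc l"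
    using hdist_triangle[OF lincomb_enum_closed x lincomb_enum_closed, of "p k" "p l"]
      hdist_commute[OF x lincomb_enum_closed, of "p l"] p[of k] p[of l] by linarith
  also have "(1/2 :: real) ^ Suc l \<le> (1/2) ^ Suc k"
    using \<open>k < l\<close> by (intro power_decreasing) auto
  finally show "hdist H (lincomb_enum K H e (p k)) (lincomb_enum K H e (p l)) < (1/2) ^ k" by simp
next
  show "(\<lambda>k. hdist H (lincomb_enum K H e (p k)) x) \<longlonglongrightarrow> 0"
  proof (rule tendsto_sandwich[OF _ _ tendsto_const])
    show "(\<lambda>k. (1/2) ^ Suc k :: real) \<longlonglongrightarrow> 0"
      by (intro LIMSEQ_Suc LIMSEQ_power_zero) simp
  qed (auto intro!: always_eventually less_imp_le[OF p] hdist_nonneg lincomb_enum_closed x simp del: power_Suc)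
qed (fact x)

end

end

section \<open>Evaluation of operator names on constant names\<close>

lemma recursive2_list_encode_replicate: "recursive2 (\<lambda>m k. list_encode (replicate k m))"
proof -
  have "recursive2 (\<lambda>m k. rec_nat 0 (\<lambda>_ r. Suc (prod_encode (m, r))) k)"
    unfolding recursive2_def
    by (rule recursive_rec_nat[where s="\<lambda>x _ r. Suc (prod_encode (pfst x, r))"])
      (auto simp: recursive3_def recursive2_def intro!: recursive_intros)
  moreover have "rec_nat 0 (\<lambda>_ r. Suc (prod_encode (m, r))) k = list_encode (replicate k m)" for m k
    by (induction k) auto
  ultimately show ?thesis by simp
qed

text \<open>Ever longer constant prefixes are offered until the associate answers. Since \<eta> is
  defined at these names, the search always ends, and the first answer is the one that
  \<open>eta\<close> prescribes.\<close>

lemma eta_const_recursive: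
  assumes P: "recursive2 P" and total: "\<And>i m. \<exists>r. eta (P i) (\<lambda>_. m) r"
  obtains Y where "recursive3 Y" "\<And>i m r. eta (P i) (\<lambda>_. m) r \<Longrightarrow> r = Y i m"
proof -
  define V where "V i m n k = P i (prod_encode (n, list_encode (replicate k m)))" for i m n k
  \<comment> \<open>\<open>1 - V\<close> is 0 exactly when the associate has answered, which turns
    the wait for a nonzero value into a search for a zero. The subtraction of 1 in \<open>Y\<close>
    removes the \<open>Suc\<close> around the answer.\<close>
  define L where "L i m n = (LEAST k. 1 - V i m n k = 0)" for i m n
  define Y where "Y i m n = V i m n (L i m n) - 1" for i m n
  have V: "recursive (\<lambda>x. V (f x) (g x) (h x) (k x))"
    if "recursive f" "recursive g" "recursive h" "recursive k" for f g h k
    unfolding V_def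
    by (intro recursive2_compose[OF P] recursive2_compose[OF recursive2_list_encode_replicate]
        recursive_intros that)
  have ex: "\<exists>k. 1 - V i m n k = 0" for i m n
  proof -
    obtain r where "eta (P i) (\<lambda>_. m) r" using total by blast
    then obtain k where "V i m n k = Suc (r n)"
      unfolding eta_def V_def map_replicate_const by fastforce
    then show ?thesis by (intro exI[of _ k]) simp
  qed
  have L: "recursive (\<lambda>x. L (pfst x) (pfst (psnd x)) (psnd (psnd x)))"
    unfolding L_def
    by (rule recursive_Least[OF _ ex]) (unfold recursive2_def, intro recursive_intros V)
  have "recursive3 Y"
    unfolding recursive3_def recursive2_def Y_def by (intro recursive_intros V L)
  moreover have "r = Y i m" if r: "eta (P i) (\<lambda>_. m) r" for i m r
  proof
    fix n
    obtain k where k: "V i m n k = Suc (r n)" "\<And>j. j < k \<Longrightarrow> V i m n j = 0"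
      using r unfolding eta_def V_def map_replicate_const by (auto simp: length_upt)
    have "L i m n = k"
      unfolding L_def by (rule Least_equality) (use k in \<open>auto simp: not_less[symmetric]\<close>)
    then show "r n = Y i m n" using k(1) by (simp add: Y_def)
  qed
  ultimately show ?thesis using that by blast
qed

section \<open>Arithmetic on codes of rationals\<close>

definition rat_add :: "nat \<Rightarrow> nat \<Rightarrow> nat" where
  "rat_add a b = prod_encode (prod_encode
    (pfst (pfst a) * Suc (psnd b) + pfst (pfst b) * Suc (psnd a),
     psnd (pfst a) * Suc (psnd b) + psnd (pfst b) * Suc (psnd a)),
    psnd a * psnd b + psnd a + psnd b)"

definition rat_mult :: "nat \<Rightarrow> nat \<Rightarrow> nat" where
  "rat_mult a b = prod_encode (prod_encode
    (pfst (pfst a) * pfst (pfst b) + psnd (pfst a) * psnd (pfst b),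
     pfst (pfst a) * psnd (pfst b) + psnd (pfst a) * pfst (pfst b)),
    psnd a * psnd b + psnd a + psnd b)"

definition rat_minus :: "nat \<Rightarrow> nat" where
  "rat_minus a = prod_encode (prod_encode (psnd (pfst a), pfst (pfst a)), psnd a)"

text \<open>Success is coded by 0 because minimisation looks for zeros; the denominator is positive,
  so the numerator decides.\<close>

definition rat_nonpos :: "nat \<Rightarrow> nat" where
  "rat_nonpos a = Suc (psnd (pfst a)) - pfst (pfst a)"

lemma rat_enum_eq: "rat_enum a = (real (pfst (pfst a)) - real (psnd (pfst a))) / real (Suc (psnd a))"
  by (simp add: rat_enum_def case_prod_beta add.commute)

text \<open>Denominators are stored minus one; this restores the product of denominators from the
  stored expression.\<close>

lemma Suc_mult_Suc: "Suc (a * b + a + b) = Suc a * Suc b"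
  by simp

lemma rat_enum_add: "rat_enum (rat_add a b) = rat_enum a + rat_enum b"
  unfolding rat_enum_eq rat_add_def prod_encode_inverse fst_conv snd_conv Suc_mult_Suc
  by (simp add: divide_simps del: of_nat_Suc) (simp add: algebra_simps)

lemma rat_enum_mult: "rat_enum (rat_mult a b) = rat_enum a * rat_enum b"
  unfolding rat_enum_eq rat_mult_def prod_encode_inverse fst_conv snd_conv Suc_mult_Suc
  by (simp add: divide_simps del: of_nat_Suc) (simp add: algebra_simps)

lemma rat_enum_minus: "rat_enum (rat_minus a) = - rat_enum a"
  by (simp add: rat_enum_eq rat_minus_def divide_simps)

lemma rat_enum_frac: "rat_enum (prod_encode (prod_encode (i, 0), k)) = real i / (real k + 1)"
  by (simp add: rat_enum_def)

lemma rat_nonpos_eq_0: "rat_nonpos a = 0 \<longleftrightarrow> 0 < rat_enum a"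
  by (auto simp: rat_nonpos_def rat_enum_eq zero_less_divide_iff)

lemma recursive_rat_add_mult [recursive_intros]:
  assumes "recursive f" "recursive g"
  shows "recursive (\<lambda>x. rat_add (f x) (g x))" "recursive (\<lambda>x. rat_mult (f x) (g x))"
  unfolding rat_add_def rat_mult_def by (intro recursive_intros assms)+

lemma recursive_rat_minus_nonpos [recursive_intros]:
  assumes "recursive f"
  shows "recursive (\<lambda>x. rat_minus (f x))" "recursive (\<lambda>x. rat_nonpos (f x))"
  unfolding rat_minus_def rat_nonpos_def by (intro recursive_intros assms)+

text \<open>The error bound mentions only the known approximation \<open>y\<close>, so it can be
  evaluated. It comes from |y + x| \<le> 2 |y| + 3 and 2 |y| \<le> y^2 + 1, whence the constant 4 =
  1 + 3.\<close>

lemma square_approx: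
  fixes x y :: real
  assumes "\<bar>y - x\<bar> \<le> \<eta>" "\<eta> \<le> 3"
  shows "\<bar>y\<^sup>2 - x\<^sup>2\<bar> \<le> \<eta> * (y\<^sup>2 + 4)"
proof -
  have "\<bar>y\<^sup>2 - x\<^sup>2\<bar> = \<bar>y - x\<bar> * \<bar>y + x\<bar>"
    by (simp add: power2_eq_square algebra_simps flip: abs_mult)
  also have "\<dots> \<le> \<eta> * (y\<^sup>2 + 4)"
  proof (rule mult_mono)
    have "0 \<le> (\<bar>y\<bar> - 1)\<^sup>2" by simp
    then have "2 * \<bar>y\<bar> \<le> y\<^sup>2 + 1" by (simp add: power2_diff)
    with assms show "\<bar>y + x\<bar> \<le> y\<^sup>2 + 4" by linarith
  qed (use assms in auto)
  finally show ?thesis .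
qed

section \<open>Frames from g-frames\<close>

text \<open>Four uses of \<open>square_approx\<close> contribute 16 = 4 * 4. The terms are grouped
  as the code \<open>U\<close> in the theorem adds them.\<close>

lemma square_combination_le:
  fixes a c g h :: real
  assumes "\<bar>a' - a\<bar> \<le> \<eta>" "\<bar>c' - c\<bar> \<le> \<eta>" "\<bar>g' - g\<bar> \<le> \<eta>" "\<bar>h' - h\<bar> \<le> \<eta>" "\<eta> \<le> 3"
  shows "a\<^sup>2 + c\<^sup>2 - g\<^sup>2 - 1 + h\<^sup>2 \<le>
    a'\<^sup>2 + c'\<^sup>2 + h'\<^sup>2 - (g'\<^sup>2 + 1) + \<eta> * (a'\<^sup>2 + c'\<^sup>2 + h'\<^sup>2 + (g'\<^sup>2 + 16))"
  using square_approx[OF assms(1,5)] square_approx[OF assms(2,5)] square_approx[OF assms(3,5)]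
    square_approx[OF assms(4,5)]
  by (simp add: algebra_simps abs_le_iff)

text \<open>Lets the errors of names be weakened to the form c / (k + 1), which for a natural c has
  the direct code \<open>prod_encode (prod_encode (c, 0), k)\<close>.\<close>

lemma half_power_le: "(1/2 :: real) ^ k \<le> 1 / (real k + 1)"
proof -
  have "real k + 1 \<le> 2 ^ k"
    using less_exp[of k] by (metis Suc_leI add.commute of_nat_Suc of_nat_le_iff of_nat_numeral of_nat_power)
  then have "1 / 2 ^ k \<le> 1 / (real k + 1)" by (intro divide_left_mono) auto
  then show ?thesis by (simp add: power_divide)
qed

lemma tendsto_inverse_linear: "(\<lambda>k. c / (real k + 1)) \<longlonglongrightarrow> 0"
  using tendsto_mult_right_zero[OF LIMSEQ_inverse_real_of_nat, of c]
  by (simp add: divide_inverse add.commute)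

lemma tendsto_of_approx:
  assumes "\<And>k. \<bar>y k - x\<bar> \<le> c / (real k + 1)"
  shows "y \<longlonglongrightarrow> x"
  by (rule LIM_zero_cancel, rule tendsto_0_le[OF tendsto_inverse_linear[of c], where K=1])
    (auto intro!: always_eventually order_trans[OF assms abs_ge_self[THEN order_trans]])

text \<open>The way back from recursive functions to functionals: one query at position 0 reads the
  number that the oracle names.\<close>

lemma computable_from_nat:
  assumes "recursive2 q" "\<And>n. \<delta> (q n) (x n)"
  shows "computable_map nat_rep \<delta> x"
proof -
  have "partrec (\<lambda>p k. Some (prod_encode (p 0, k)))"
    using partrec.pair[OF partrec.comp[OF partrec.query partrec.zero] recursive_id[unfolded recursive_def]]
    by simp
  from partrec.comp[OF assms(1)[unfolded recursive2_def recursive_def] this]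
  have "partrec (\<lambda>p k. Some (q (p 0) k))" by simp
  with assms(2) show ?thesis
    by (auto simp: computable_family_def nat_rep_def computes_def)
qed

text \<open>Acceptance is sound because \<open>U\<close> bounds \<open>v\<close> from above, and the
  search ends because \<open>U\<close> converges to \<open>v\<close>, which takes arbitrarily small
  values. Its variable codes a point together with a precision, so no single point can block
  it.\<close>

lemma recursive_search_below:
  assumes U: "recursive3 U"
    and upper: "\<And>n m j. v n m \<le> rat_enum (U n m j)"
    and lim: "\<And>n m. (\<lambda>j. rat_enum (U n m j)) \<longlonglongrightarrow> v n m"
    and inf: "\<And>n \<epsilon>. \<epsilon> > 0 \<Longrightarrow> \<exists>m. v n m < \<epsilon>"
  obtains q where "recursive2 q" "\<And>n k. v n (q n k) < (1/4) ^ Suc k"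
proof -
  \<comment> \<open>A code of \<open>(1/4) ^ Suc k\<close> minus the upper bound; the denominator
    \<open>4 ^ Suc k\<close> is again stored minus one.\<close>
  define T where "T n k w = rat_add (rat_minus (U n (pfst w) (psnd w)))
      (prod_encode (prod_encode (1, 0), 4 ^ Suc k - 1))" for n k w
  define W where "W n k = (LEAST w. rat_nonpos (T n k w) = 0)" for n k
  have T: "rat_nonpos (T n k w) = 0 \<longleftrightarrow> rat_enum (U n (pfst w) (psnd w)) < (1/4) ^ Suc k" for n k w
  proof -
    have "real (4 ^ Suc k - 1) + 1 = 4 ^ Suc k" by (subst of_nat_diff) auto
    then have "rat_enum (prod_encode (prod_encode (1, 0), 4 ^ Suc k - 1)) = (1/4) ^ Suc k"
      by (simp add: rat_enum_frac power_divide)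
    then show ?thesis by (simp only: T_def rat_nonpos_eq_0 rat_enum_add rat_enum_minus) linarith
  qed
  have ex: "\<exists>w. rat_nonpos (T n k w) = 0" for n k
  proof -
    obtain m where "v n m < (1/4) ^ Suc k" using inf[of "(1/4) ^ Suc k" n] by auto
    with lim have "eventually (\<lambda>j. rat_enum (U n m j) < (1/4) ^ Suc k) sequentially"
      by (rule order_tendstoD)
    then obtain j where "rat_enum (U n m j) < (1/4) ^ Suc k" by (auto simp: eventually_sequentially)
    then show ?thesis unfolding T by (intro exI[of _ "prod_encode (m, j)"]) simp
  qed
  have "recursive2 W"
    unfolding W_def recursive2_def
    by (rule recursive_Least[OF _ ex], unfold recursive2_def T_def)
      (intro recursive_intros recursive3_compose[OF U])
  then have "recursive2 (\<lambda>n k. pfst (W n k))"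
    unfolding recursive2_def by (intro recursive_intros)
  moreover have "v n (pfst (W n k)) < (1/4) ^ Suc k" for n k
    using LeastI_ex[OF ex[of n k], folded W_def, unfolded T]
      upper[of n "pfst (W n k)" "psnd (W n k)"] by linarith
  ultimately show ?thesis using that by blast
qed

text \<open>The squared distances on the two sides contain the same mixed term, as the adjoint moves
  \<open>T\<close> across the inner product; eliminating it leaves only norms and distances.\<close>

lemma hdist_hadjoint_sq:
  assumes H: "hilbert_space K H" and G: "hilbert_space K G" and T: "bounded_operator K H G T"
    and x: "x \<in> hcarrier H" and y: "y \<in> hcarrier G"
  shows "(hdist H x (hadjoint H G T y))\<^sup>2 =
    (hnorm H x)\<^sup>2 + (hnorm H (hadjoint H G T y))\<^sup>2 - (hnorm G (T x))\<^sup>2 - (hnorm G y)\<^sup>2 + (hdist G (T x) y)\<^sup>2"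
proof -
  have "T x \<in> hcarrier G" using T x by (auto simp: bounded_operator_def)
  then show ?thesis
    unfolding hdist_def
    by (simp add: hilbert_space.hnorm_diff_sq[OF H x] hilbert_space.hnorm_diff_sq[OF G]
        hadjoint_works[OF H G T y] x y)
qed

lemma frame_hadjoint:
  assumes H: "hilbert_space K H" and Hs: "\<And>i. hilbert_space K (Hs i)"
    and \<Lambda>: "g_frame K H Hs \<Lambda>" and b: "\<And>i. orthonormal_basis K (Hs i) (b i)"
  shows "frame H (\<lambda>n. case prod_decode n of (i, j) \<Rightarrow> hadjoint H (Hs i) (\<Lambda> i) (b i j))"
proof -
  let ?f = "\<lambda>n. case prod_decode n of (i, j) \<Rightarrow> hadjoint H (Hs i) (\<Lambda> i) (b i j)"
  have bo: "bounded_operator K H (Hs i) (\<Lambda> i)" for i using \<Lambda> by (simp add: g_frame_def)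
  let ?g = "\<lambda>x i. (hnorm (Hs i) (\<Lambda> i x))\<^sup>2"
  obtain A B where AB: "0 < A" "A \<le> B" and bounds: "\<forall>x\<in>hcarrier H. summable (?g x) \<and>
      A * (hnorm H x)\<^sup>2 \<le> suminf (?g x) \<and> suminf (?g x) \<le> B * (hnorm H x)\<^sup>2"
    using \<Lambda> unfolding g_frame_def by (elim conjE exE)
  have bc: "b i j \<in> hcarrier (Hs i)" for i j using b[of i] by (auto simp: orthonormal_basis_def)
  note adj = hadjoint_works[OF H Hs bo bc]
  have sums: "(\<lambda>n. (cmod (hinner H x (?f n)))\<^sup>2) sums suminf (?g x)" if x: "x \<in> hcarrier H" for x
  proof -
    \<comment> \<open>These are the squared Fourier coefficients of \<open>\<Lambda> i x\<close>.
      Listed through \<open>prod_decode\<close> they add up to the g-frame sum, so \<open>A\<close>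
      and \<open>B\<close> carry over unchanged.\<close>
    define t where "t = (\<lambda>(i, j). (cmod (hinner (Hs i) (\<Lambda> i x) (b i j)))\<^sup>2)"
    have "\<Lambda> i x \<in> hcarrier (Hs i)" for i using bo[of i] x by (simp add: bounded_operator_def)
    then have "(\<lambda>j. t (i, j)) sums ?g x i" for i
      unfolding t_def prod.case by (rule hilbert_space.parseval[OF Hs b])
    moreover have "0 \<le> t z" for z by (simp add: t_def case_prod_beta)
    moreover have "summable (?g x)" using bounds x by blast
    ultimately have "(\<lambda>n. t (prod_decode n)) sums suminf (?g x)"
      by (intro sums_prod_decode[where t = t and g = "?g x"])
    then show ?thesis by (simp add: t_def case_prod_beta adj(2)[OF x])
  qed
  show ?thesis
    unfolding frame_def
  proof (rule conjI, goal_cases)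
    case 1
    show ?case using adj(1) by (auto simp: case_prod_beta)
  next
    case 2
    show ?case
    proof (rule exI[of _ A], rule exI[of _ B], intro conjI ballI AB)
      fix x assume x: "x \<in> hcarrier H"
      note eq = sums_unique[OF sums[OF x], symmetric]
      show "summable (\<lambda>n. (cmod (hinner H x (?f n)))\<^sup>2)" by (rule sums_summable[OF sums[OF x]])
      show "A * (hnorm H x)\<^sup>2 \<le> (\<Sum>n. (cmod (hinner H x (?f n)))\<^sup>2)"
        and "(\<Sum>n. (cmod (hinner H x (?f n)))\<^sup>2) \<le> B * (hnorm H x)\<^sup>2"
        unfolding eq using bspec[OF bounds x] by simp_all
    qed
  qed
qed

theorem theorem3p6:
  fixes K :: "complex set"
    and H :: "'a::ab_group_add hilbert" and e :: "nat \<Rightarrow> 'a"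
    and Hs :: "nat \<Rightarrow> 'b::ab_group_add hilbert" and es :: "nat \<Rightarrow> nat \<Rightarrow> 'b"
    and b :: "nat \<Rightarrow> nat \<Rightarrow> 'b" and \<Lambda> :: "nat \<Rightarrow> 'a \<Rightarrow> 'b"
  assumes "computable_hilbert K H e"
    and "computable_hilbert_seq K Hs es"
    and "computable_orthonormal_bases K Hs es b"
    and "computable_g_frame K H e Hs es \<Lambda>"
    and "computable_map (prod_rep nat_rep nat_rep) real_rep
      (\<lambda>(i, j). hnorm H (hadjoint H (Hs i) (\<Lambda> i) (b i j)))"
  shows "computable_frame K H e
    (\<lambda>n. case prod_decode n of (i, j) \<Rightarrow> hadjoint H (Hs i) (\<Lambda> i) (b i j))"
proof -
  define f where "f n = (case prod_decode n of (i, j) \<Rightarrow> hadjoint H (Hs i) (\<Lambda> i) (b i j))" for n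
  let ?\<alpha> = "lincomb_enum K H e" and ?\<beta> = "\<lambda>i. lincomb_enum K (Hs i) (es i)"
  have H: "hilbert_space K H" and e: "range e \<subseteq> hcarrier H" "hdense H (hspan K H (range e))"
    using assms(1) by (auto simp: computable_hilbert_def)
  have Hs: "hilbert_space K (Hs i)" and es: "range (es i) \<subseteq> hcarrier (Hs i)" for i
    using assms(2) by (auto simp: computable_hilbert_seq_def computable_hilbert_def)
  interpret H: hilbert_space K H by (rule H)
  interpret Hs: hilbert_space K "Hs i" for i by (rule Hs)
  note \<alpha>c = H.lincomb_enum_closed[OF e(1)] and \<beta>c = Hs.lincomb_enum_closed[OF es]
  have b: "\<And>i. orthonormal_basis K (Hs i) (b i)"
    using assms(3) by (auto simp: computable_orthonormal_bases_def)
  have bc: "b i j \<in> hcarrier (Hs i)" and b1: "hnorm (Hs i) (b i j) = 1" for i j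
    using b[of i] by (auto simp: orthonormal_basis_def hnorm_def)
  have \<Lambda>: "g_frame K H Hs \<Lambda>" using assms(4) by (simp add: computable_g_frame_def)
  then have bo: "bounded_operator K H (Hs i) (\<Lambda> i)" for i by (simp add: g_frame_def)
  then have \<Lambda>c: "\<Lambda> i (?\<alpha> m) \<in> hcarrier (Hs i)" for i m
    using \<alpha>c by (auto simp: bounded_operator_def)
  have fc: "f n \<in> hcarrier H" for n
    using hadjoint_works(1)[OF H Hs bo bc] by (simp add: f_def case_prod_beta)

  obtain qH where qH: "recursive2 qH"
    "\<And>n m. real_rep (qH (prod_encode (n, m))) (hdist H (?\<alpha> n) (?\<alpha> m))"
    using assms(1) unfolding computable_hilbert_def by (auto elim: computable_on_nat_pairs)
  obtain qS where qS: "recursive2 qS"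
    "\<And>i n m. real_rep (qS (prod_encode (i, prod_encode (n, m)))) (hdist (Hs i) (?\<beta> i n) (?\<beta> i m))"
    using assms(2) unfolding computable_hilbert_seq_def by (auto elim: computable_on_nat_triples)
  obtain qB where qB: "recursive2 qB"
    "\<And>i j. hilbert_rep K (Hs i) (es i) (qB (prod_encode (i, j))) (b i j)"
    using assms(3) unfolding computable_orthonormal_bases_def by (auto elim: computable_on_nat_pairs)
  obtain qF where qF: "recursive2 qF"
    "\<And>i j. real_rep (qF (prod_encode (i, j))) (hnorm H (hadjoint H (Hs i) (\<Lambda> i) (b i j)))"
    using assms(5) by (auto elim: computable_on_nat_pairs)
  obtain P where P: "recursive2 P"
    "\<And>i. fun_rep (hilbert_rep K H e) (hilbert_rep K (Hs i) (es i)) (P i) (\<Lambda> i)"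
    using assms(4) unfolding computable_g_frame_def by (auto elim: computable_on_nat)
  \<comment> \<open>The constant sequence \<open>m\<close> names the dense point with index
    \<open>m\<close>, so \<open>P i\<close> turns it into a name of its image.\<close>
  have \<Lambda>_name: "\<exists>r. eta (P i) (\<lambda>_. m) r \<and> hilbert_rep K (Hs i) (es i) r (\<Lambda> i (?\<alpha> m))" for i m
    using P(2)[of i] H.hilbert_rep_const[OF e(1), of m] unfolding fun_rep_def by blast
  obtain Y where Y: "recursive3 Y" "\<And>i m r. eta (P i) (\<lambda>_. m) r \<Longrightarrow> r = Y i m"
    by (rule eta_const_recursive[OF P(1)]) (use \<Lambda>_name in blast)+
  have Y_rep: "hilbert_rep K (Hs i) (es i) (Y i m) (\<Lambda> i (?\<alpha> m))" for i m
    using \<Lambda>_name[of i m] Y(2) by blast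

  \<comment> \<open>Index 0 codes the empty linear combination, so norms are distances to point 0.
    The number \<open>n\<close> is itself the code of the pair (i, j), which is why
    \<open>qB n\<close> and \<open>qF n\<close> occur below.\<close>
  define qa where "qa m j = qH (prod_encode (m, 0)) j" for m j
  define qg where "qg n m j = qS (prod_encode (pfst n, prod_encode (Y (pfst n) m j, 0))) j" for n m j
  define qh where "qh n m j = qS (prod_encode (pfst n, prod_encode (Y (pfst n) m j, qB n j))) j" for n m j
  \<comment> \<open>The worst quantity, \<open>qh\<close>, collects three errors of size
    \<open>(1/2) ^ j\<close>: from the rational, from the name of the image and from the name of the
    basis vector. The value never exceeds 3, as \<open>square_approx\<close> demands.\<close>
  define \<eta> where "\<eta> j = 3 / (real j + 1)" for j
  have \<eta>: "3 * (1/2) ^ j \<le> \<eta> j" "\<eta> j \<le> 3" for j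
    using half_power_le[of j] by (auto simp: \<eta>_def divide_simps)
  have half_nonneg: "0 \<le> (1/2 :: real) ^ j" for j by simp

  have a: "\<bar>rat_enum (qa m j) - hnorm H (?\<alpha> m)\<bar> \<le> \<eta> j" for m j
    using real_rep_dist[OF qH(2), of m 0 j] \<eta>(1)[of j] half_nonneg[of j]
    by (simp add: qa_def H.lincomb_enum_zero)
  have c: "\<bar>rat_enum (qF n j) - hnorm H (f n)\<bar> \<le> \<eta> j" for n j
    using real_rep_dist[OF qF(2), of "pfst n" "psnd n" j] \<eta>(1)[of j] half_nonneg[of j]
    by (simp add: f_def case_prod_beta)
  have Y_dist: "hdist (Hs i) (?\<beta> i (Y i m j)) (\<Lambda> i (?\<alpha> m)) \<le> (1/2) ^ j" for i m j
    by (rule Hs.hilbert_rep_dist[OF es Y_rep])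
  have g: "\<bar>rat_enum (qg n m j) - hnorm (Hs (pfst n)) (\<Lambda> (pfst n) (?\<alpha> m))\<bar> \<le> \<eta> j" for n m j
  proof -
    let ?i = "pfst n"
    have "\<bar>rat_enum (qg n m j) - hnorm (Hs ?i) (?\<beta> ?i (Y ?i m j))\<bar> \<le> (1/2) ^ j"
      using real_rep_dist[OF qS(2), of ?i "Y ?i m j" 0 j] by (simp add: qg_def Hs.lincomb_enum_zero)
    with Hs.hnorm_diff_le[OF \<beta>c \<Lambda>c, of ?i "Y ?i m j" m] Y_dist[of ?i m j] \<eta>(1)[of j] half_nonneg[of j]
    show ?thesis by linarith
  qed
  have h: "\<bar>rat_enum (qh n m j) - hdist (Hs (pfst n)) (\<Lambda> (pfst n) (?\<alpha> m)) (b (pfst n) (psnd n))\<bar> \<le> \<eta> j"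
    for n m j
  proof -
    let ?i = "pfst n"
    let ?y = "?\<beta> ?i (Y ?i m j)" and ?z = "?\<beta> ?i (qB n j)"
      and ?y' = "\<Lambda> ?i (?\<alpha> m)" and ?z' = "b ?i (psnd n)"
    have "\<bar>rat_enum (qh n m j) - hdist (Hs ?i) ?y ?z\<bar> \<le> (1/2) ^ j"
      using real_rep_dist[OF qS(2), of ?i "Y ?i m j" "qB n j" j] by (simp add: qh_def)
    moreover have "hdist (Hs ?i) ?z ?z' \<le> (1/2) ^ j"
      using Hs.hilbert_rep_dist[OF es qB(2), of ?i "psnd n" j] by simp
    moreover have "hdist (Hs ?i) ?y ?z \<le> hdist (Hs ?i) ?y ?y' + hdist (Hs ?i) ?y' ?z"
      "hdist (Hs ?i) ?y' ?z \<le> hdist (Hs ?i) ?y' ?z' + hdist (Hs ?i) ?z' ?z"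
      "hdist (Hs ?i) ?y' ?z' \<le> hdist (Hs ?i) ?y' ?y + hdist (Hs ?i) ?y ?z'"
      "hdist (Hs ?i) ?y ?z' \<le> hdist (Hs ?i) ?y ?z + hdist (Hs ?i) ?z ?z'"
      "hdist (Hs ?i) ?z' ?z = hdist (Hs ?i) ?z ?z'" "hdist (Hs ?i) ?y' ?y = hdist (Hs ?i) ?y ?y'"
      by (intro Hs.hdist_triangle Hs.hdist_commute \<beta>c \<Lambda>c bc)+
    ultimately show ?thesis using Y_dist[of ?i m j] \<eta>(1)[of j] by linarith
  qed

  define v where "v n m = (hdist H (?\<alpha> m) (f n))\<^sup>2" for n m
  have v: "v n m = (hnorm H (?\<alpha> m))\<^sup>2 + (hnorm H (f n))\<^sup>2 - (hnorm (Hs (pfst n)) (\<Lambda> (pfst n) (?\<alpha> m)))\<^sup>2 - 1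
      + (hdist (Hs (pfst n)) (\<Lambda> (pfst n) (?\<alpha> m)) (b (pfst n) (psnd n)))\<^sup>2" for n m
    using hdist_hadjoint_sq[OF H Hs bo \<alpha>c bc, of m "pfst n" "psnd n"] b1[of "pfst n" "psnd n"]
    by (simp add: v_def f_def case_prod_beta)
  define N where "N k = prod_encode (prod_encode (k, 0), 0)" for k
  \<comment> \<open>The polarization formula evaluated at the approximations, plus its error bound;
    \<open>E\<close> and \<open>G\<close> serve in both parts.\<close>
  define U where "U n m j =
    (let A = rat_mult (qa m j) (qa m j); C = rat_mult (qF n j) (qF n j);
      G = rat_mult (qg n m j) (qg n m j); D = rat_mult (qh n m j) (qh n m j);
      E = rat_add (rat_add A C) D
    in rat_add (rat_add E (rat_minus (rat_add G (N 1))))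
      (rat_mult (prod_encode (prod_encode (3, 0), j)) (rat_add E (rat_add G (N 16)))))" for n m j
  have U: "rat_enum (U n m j) =
      (rat_enum (qa m j))\<^sup>2 + (rat_enum (qF n j))\<^sup>2 + (rat_enum (qh n m j))\<^sup>2 - ((rat_enum (qg n m j))\<^sup>2 + 1)
      + \<eta> j * ((rat_enum (qa m j))\<^sup>2 + (rat_enum (qF n j))\<^sup>2 + (rat_enum (qh n m j))\<^sup>2 + ((rat_enum (qg n m j))\<^sup>2 + 16))"
    for n m j
    by (simp add: U_def Let_def N_def rat_enum_add rat_enum_mult rat_enum_minus rat_enum_frac \<eta>_def power2_eq_square)
  have U_rec: "recursive3 U"
    unfolding recursive3_def recursive2_def U_def Let_def qa_def qg_def qh_def
    by (intro recursive_intros recursive2_compose[OF qH(1)] recursive2_compose[OF qS(1)]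
        recursive2_compose[OF qB(1)] recursive2_compose[OF qF(1)] recursive3_compose[OF Y(1)])
  have upper: "v n m \<le> rat_enum (U n m j)" for n m j
    unfolding v U by (rule square_combination_le[OF a c g h \<eta>(2)])
  have lim: "(\<lambda>j. rat_enum (U n m j)) \<longlonglongrightarrow> v n m" for n m
  proof -
    note lims = tendsto_of_approx[OF a[unfolded \<eta>_def]] tendsto_of_approx[OF c[unfolded \<eta>_def]]
      tendsto_of_approx[OF g[unfolded \<eta>_def]] tendsto_of_approx[OF h[unfolded \<eta>_def]]
    have \<eta>0: "\<eta> \<longlonglongrightarrow> 0" unfolding \<eta>_def by (rule tendsto_inverse_linear)
    show ?thesis
      unfolding U v by (rule tendsto_eq_intros lims \<eta>0 refl | simp)+
  qed
  have dense: "\<exists>m. v n m < \<epsilon>" if "\<epsilon> > 0" for n \<epsilon>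
  proof -
    obtain m where m: "hdist H (?\<alpha> m) (f n) < sqrt \<epsilon>"
      using H.lincomb_enum_dense[OF e fc, of "sqrt \<epsilon>" n] \<open>\<epsilon> > 0\<close> by auto
    then have "v n m < (sqrt \<epsilon>)\<^sup>2"
      unfolding v_def by (intro power_strict_mono H.hdist_nonneg \<alpha>c fc) auto
    then show ?thesis using \<open>\<epsilon> > 0\<close> by auto
  qed
  obtain q where q: "recursive2 q" "\<And>n k. v n (q n k) < (1/4) ^ Suc k"
    using recursive_search_below[OF U_rec upper lim dense] by blast
  have "hilbert_rep K H e (q n) (f n)" for n
  proof (rule H.hilbert_repI[OF e(1) fc])
    fix k
    \<comment> \<open>The search bounds squared distances by powers of 1/4; taking roots gives the
      bound \<open>(1/2) ^ Suc k\<close> that \<open>hilbert_repI\<close> asks for.\<close>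
    have "(1/2 :: real)\<^sup>2 = 1/4" by (simp add: power2_eq_square)
    then have "((1/2 :: real) ^ Suc k)\<^sup>2 = (1/4) ^ Suc k" by (metis power_mult mult.commute)
    with q(2)[of n k] have "(hdist H (?\<alpha> (q n k)) (f n))\<^sup>2 < ((1/2) ^ Suc k)\<^sup>2"
      by (simp only: v_def)
    then show "hdist H (?\<alpha> (q n k)) (f n) < (1/2) ^ Suc k"
      by (rule power2_less_imp_less) simp
  qed
  then have "computable_map nat_rep (hilbert_rep K H e) f"
    by (rule computable_from_nat[of q "hilbert_rep K H e" f, OF q(1)])
  with frame_hadjoint[OF H Hs \<Lambda> b] show ?thesis
    by (simp add: computable_frame_def f_def[abs_def])
qed

end
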